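(* Let $\mathcal{K}$ be an abstract elementary class (AEC) with intersections. Then there are: (1) a functorial expansion $\mathcal{K}^+$ of $\mathcal{K}$ with vocabulary $\tau^+=\tau(\mathcal{K})\cup\{E_n\mid n<\omega\}$, and (2) a $\forall Q^{\text{struct}}$-theory $T$ in $\mathbb{L}^{\operatorname{LS}(\mathcal{K})^+\text{-struct}}_{(\operatorname{LS}(\mathcal{K})+|\mathbf{D}(\mathcal{K})|)^+,\,\omega}(\tau^+)$, such that $\mathcal{K}^+=\operatorname{Mod}_{\mathcal{F}}(T)$, where $\mathcal{F}$ is the smallest fragment containing $T$.
   Context: The symbols $E_n$ ($n<\omega$) are relation symbols of finite arity added to $\tau(\mathcal{K})$. Structures: vocabularies are finitary; structures are allowed to have empty universe (when the vocabulary has no constant symbols). $|M|$ is the universe of $M$ and $\|M\|$ its cardinality. AEC: an abstract elementary class is a pair $\mathcal{K}=(K,\le_{\mathcal{K}})$ such that: (1) $K$ is a class of structures in a fixed vocabulary $\tau(\mathcal{K})$, $\le_{\mathcal{K}}$ is a partial order on $K$, $M\le_{\mathcal{K}} N$ implies $M\subseteq N$ (substructure), and $K$ and $\le_{\mathcal{K}}$ are closed under isomorphisms; (2) coherence: if $M_0,M_1,M_2\in K$, $M_0\subseteq M_1\le_{\mathcal{K}} M_2$ and $M_0\le_{\mathcal{K}} M_2$, then $M_0\le_{\mathcal{K}} M_1$; (3) Tarski–Vaught chain axioms: if $\delta$ is a limit ordinal, $\langle M_i:i<\delta\rangle$ is $\le_{\mathcal{K}}$-increasing and $M=\bigcup_{i<\delta}M_i$,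 then $M\in K$, $M_0\le_{\mathcal{K}} M$, and if $N\in K$ satisfies $M_i\le_{\mathcal{K}} N$ for all $i<\delta$ then $M\le_{\mathcal{K}} N$; (4) Löwenheim–Skolem–Tarski axiom: there is a cardinal $\lambda\ge|\tau(\mathcal{K})|+\aleph_0$ such that for every $N\in K$ and $A\subseteq|N|$ there is $M\in K$ with $A\subseteq|M|$, $M\le_{\mathcal{K}} N$ and $\|M\|\le|A|+\lambda$. The least such $\lambda$ is $\operatorname{LS}(\mathcal{K})$, the Löwenheim–Skolem–Tarski number. Intersections: for $N\in K$ and $A\subseteq|N|$, $c\ell^N(A)$ is the intersection of all (universes of) $N_0\le_{\mathcal{K}} N$ with $A\subseteq|N_0|$; it is also viewed as the $\tau(\mathcal{K})$-substructure of $N$ with that universe. For a sequence $\mathbf{a}$, $c\ell^N(\mathbf{a})=c\ell^N(\operatorname{ran}(\mathbf{a}))$. $\mathcal{K}$ has intersections if $c\ell^N(A)\le_{\mathcal{K}} N$ for all $N\in K$ and $A\subseteq|N|$. The set $\mathbf{D}(\mathcal{K})$: for $\mathcal{K}$ an AEC with intersections, $M,N\in K$, and finite sequences $\mathbf{a}$ from $M$ and $\mathbf{b}$ from $N$, write $(\mathbf{a},M)\equiv(\mathbf{b},N)$ if there is an isomorphism $f:c\ell^M(\mathbf{a})\cong c\ell^N(\mathbf{b})$ with $f(\mathbf{a})=\mathbf{b}$. This is an equivalence relation and $\mathbf{D}(\mathcal{K})$ denotes the set of its equivalence classes. Functorial expansion: a functorial expansion of an AEC $\mathcal{K}$ is a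 class $K^+$ of structures in a vocabulary $\tau(K^+)\supseteq\tau(\mathcal{K})$ (finitary) such that the reduct map $M\mapsto M\restriction\tau(\mathcal{K})$ is a structure-preserving bijection from $K^+$ onto $K$: any isomorphism between two members of $K$ is also an isomorphism between their expansions in $K^+$, and if $M\le_{\mathcal{K}} N$ then the expansion of $M$ is a substructure of the expansion of $N$. One sets $\mathcal{K}^+=(K^+,\le_{\mathcal{K}^+})$ where $M\le_{\mathcal{K}^+}N$ iff $M\restriction\tau(\mathcal{K})\le_{\mathcal{K}} N\restriction\tau(\mathcal{K})$; $\mathcal{K}^+$ is also called a functorial expansion of $\mathcal{K}$. Structural logic: let $\tau$ be a vocabulary, $\kappa$ an infinite cardinal, and $\lambda$ an infinite cardinal. $\mathbb{L}^{\kappa\text{-struct}}_{\lambda,\omega}(\tau)$ is $\mathbb{L}_{\lambda,\omega}(\tau)$ (conjunctions and disjunctions of length $<\lambda$, finite quantifier strings, finitely many free variables) closed additionally under the following: if $n<\omega$, $\phi(x,\mathbf{z})$ and $\psi_i(y_i,\mathbf{z})$ ($i<n$) are formulas, $\tau_0\subseteq\tau$ is a sub-vocabulary, $M$ is a $\tau_0$-structure whose universe is an ordinal $<\kappa$, and $\mathbf{A}=\langle A_i:i<n\rangle$ are subsets of $|M|$, then, writing $\mathbf{y}=\langle y_i:i<n\rangle$, $Q^{\text{struct}}_{M,\mathbf{A}}\,x\,\mathbf{y}\,\phi(x,\mathbf{z})\langle\psi_i(y_i,\mathbf{z}):i<n\rangle$ is a formula. Its satisfaction: $N\models Q^{\text{struct}}_{M,\mathbf{A}}\,x\,\mathbf{y}\,\phi(x,\mathbf{b})\langle\psi_i(y_i,\mathbf{b}):i<n\rangle$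 iff (i) $N\models\forall x(\psi_i(x,\mathbf{b})\to\phi(x,\mathbf{b}))$ for all $i<n$, and (ii) there is a $\tau_0$-substructure $N_0$ of $N$ with universe $\phi(N,\mathbf{b})$ and an isomorphism $f$ from $N_0$ onto $M$ with $f[\psi_i(N,\mathbf{b})]=A_i$ for all $i<n$. A $\forall Q^{\text{struct}}$-sentence is a sentence of the form $\forall\mathbf{z}\bigvee_{(M,\mathbf{A})\in S}Q^{\text{struct}}_{M,\mathbf{A}}\,x\,\mathbf{y}\,\phi(x,\mathbf{z})\langle\psi_i(y_i,\mathbf{z}):i<n\rangle$ with $\phi$ and the $\psi_i$ quantifier-free and $S$ a non-empty set. A $\forall Q^{\text{struct}}$-theory is a theory consisting exclusively of $\forall Q^{\text{struct}}$-sentences. Fragments and ordering: a fragment $\mathcal{F}$ is a set of formulas closed under subformulas and containing all atomic formulas (closure under finitary operations is not required). For $\tau$-structures $N_1\subseteq N_2$ and a fragment $\mathcal{F}$ of structural logic with parameter $\kappa$, $N_1\preceq_{\mathcal{F}}N_2$ means $N_1\models\phi(\mathbf{a})\iff N_2\models\phi(\mathbf{a})$ for all $\phi\in\mathcal{F}$ and $\mathbf{a}\in N_1$. $N_1\preceq^*_{\mathcal{F}}N_2$ means: $N_1\preceq_{\mathcal{F}}N_2$, and for every formula $Q^{\text{struct}}_{M,\mathbf{A}}\,x\,\mathbf{y}\,\phi(x,\mathbf{z})\langle\psi_i(y_i,\mathbf{z}):i<n\rangle$ in $\mathcal{F}$ and every $\mathbf{b}\in N_1$, if $|\phi(N_1,\mathbf{b})|<\kappa$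 then $\phi(N_1,\mathbf{b})=\phi(N_2,\mathbf{b})$ and $\psi_i(N_1,\mathbf{b})=\psi_i(N_2,\mathbf{b})$ for all $i<n$. For a theory $T\subseteq\mathcal{F}$, $\operatorname{Mod}_{\mathcal{F}}(T)$ is the pair $(\operatorname{Mod}(T),\preceq^*_{\mathcal{F}})$. *)

theory Defs
  imports Main
begin

unbundle cardinal_syntax

text \<open>
  The background set theory. A type \<open>'u\<close>, which stays arbitrary, plays the role of the
  set-theoretic universe: a subset of \<open>'u\<close> is a set (as opposed to a proper class) iff it has
  fewer elements than \<open>'u\<close>, and a class of structures is an arbitrary HOL set of structures
  whose universes are sets in this sense. For \<open>'u\<close> a model of ZFC set theory in HOL, in which
  the sets are exactly the subcollections smaller than the universe, these are the usual notions;
  nothing (such as inaccessibility of the size of \<open>'u\<close>) is assumed. Set-sized cardinals and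
  ordinals are well-orders on subsets of \<open>'u\<close>.
\<close>

definition set_sized :: "'u set \<Rightarrow> bool"
  where "set_sized A \<longleftrightarrow> |A| <o |UNIV :: 'u set|"


section \<open>Vocabularies and structures\<close>

text \<open>A vocabulary maps its symbols to their arities; constants are nullary function symbols.\<close>

datatype ('f, 'r) vocab = Vocab (funs: "'f \<rightharpoonup> nat") (rels: "'r \<rightharpoonup> nat")

definition subvocab :: "('f, 'r) vocab \<Rightarrow> ('f, 'r) vocab \<Rightarrow> bool"
  where "subvocab \<sigma> \<tau> \<longleftrightarrow> funs \<sigma> \<subseteq>\<^sub>m funs \<tau> \<and> rels \<sigma> \<subseteq>\<^sub>m rels \<tau>"

abbreviation symbols :: "('f, 'r) vocab \<Rightarrow> ('f + 'r) set"
  where "symbols \<tau> \<equiv> dom (funs \<tau>) <+> dom (rels \<tau>)"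

datatype ('u, 'f, 'r) struct =
  Struct (voc: "('f, 'r) vocab") (univ: "'u set")
    (fint: "'f \<Rightarrow> 'u list \<Rightarrow> 'u") (rint: "'r \<Rightarrow> 'u list set")

definition tuples :: "nat \<Rightarrow> 'u set \<Rightarrow> 'u list set"
  where "tuples n A = {xs. length xs = n \<and> set xs \<subseteq> A}"

text \<open>
  Interpretations are normalised outside their proper domain, so that equality of structures in
  HOL is equality of structures in the mathematical sense. Empty universes are allowed.
\<close>

definition is_structure :: "('u, 'f, 'r) struct \<Rightarrow> bool" where
  "is_structure M \<longleftrightarrow>
     set_sized (univ M) \<and>
     (\<forall>g xs. case funs (voc M) g of
        Some n \<Rightarrow> if xs \<in> tuples n (univ M) then fint M g xs \<in> univ M else fint M g xs = undefined
      | None \<Rightarrow> fint M g xs = undefined) \<and>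
     (\<forall>R. case rels (voc M) R of
        Some n \<Rightarrow> rint M R \<subseteq> tuples n (univ M)
      | None \<Rightarrow> rint M R = {})"

definition substructure :: "('u, 'f, 'r) struct \<Rightarrow> ('u, 'f, 'r) struct \<Rightarrow> bool" where
  "substructure M N \<longleftrightarrow>
     is_structure M \<and> is_structure N \<and> voc M = voc N \<and> univ M \<subseteq> univ N \<and>
     (\<forall>g n. funs (voc M) g = Some n \<longrightarrow> (\<forall>xs \<in> tuples n (univ M). fint M g xs = fint N g xs)) \<and>
     (\<forall>R n. rels (voc M) R = Some n \<longrightarrow> (\<forall>xs \<in> tuples n (univ M). xs \<in> rint M R \<longleftrightarrow> xs \<in> rint N R))"

text \<open>The values of an isomorphism outside the universe of its domain are irrelevant.\<close>

definition iso :: "('u \<Rightarrow> 'v) \<Rightarrow> ('u, 'f, 'r) struct \<Rightarrow> ('v, 'f, 'r) struct \<Rightarrow> bool" where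
  "iso h M N \<longleftrightarrow>
     is_structure M \<and> is_structure N \<and> voc M = voc N \<and> bij_betw h (univ M) (univ N) \<and>
     (\<forall>g n. funs (voc M) g = Some n \<longrightarrow>
        (\<forall>xs \<in> tuples n (univ M). h (fint M g xs) = fint N g (map h xs))) \<and>
     (\<forall>R n. rels (voc M) R = Some n \<longrightarrow>
        (\<forall>xs \<in> tuples n (univ M). xs \<in> rint M R \<longleftrightarrow> map h xs \<in> rint N R))"

definition reduct :: "('f, 'r) vocab \<Rightarrow> ('u, 'f, 'r) struct \<Rightarrow> ('u, 'f, 'r) struct" where
  "reduct \<sigma> M = Struct \<sigma> (univ M)
     (\<lambda>g. if g \<in> dom (funs \<sigma>) then fint M g else (\<lambda>_. undefined))
     (\<lambda>R. if R \<in> dom (rels \<sigma>) then rint M R else {})"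

text \<open>A structure only if the set \<open>A\<close> is closed under the functions of the structure.\<close>

definition restrict :: "('u, 'f, 'r) struct \<Rightarrow> 'u set \<Rightarrow> ('u, 'f, 'r) struct" where
  "restrict M A = Struct (voc M) A
     (\<lambda>g xs. if set xs \<subseteq> A then fint M g xs else undefined)
     (\<lambda>R. {xs \<in> rint M R. set xs \<subseteq> A})"

text \<open>
  The union of a chain of structures is the unique structure on the union of the universes that
  extends all members of the chain.
\<close>

definition is_union :: "'i set \<Rightarrow> ('i \<Rightarrow> ('u, 'f, 'r) struct) \<Rightarrow> ('u, 'f, 'r) struct \<Rightarrow> bool" where
  "is_union I M U \<longleftrightarrow>
     is_structure U \<and> univ U = (\<Union>i\<in>I. univ (M i)) \<and> (\<forall>i\<in>I. substructure (M i) U)"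


section \<open>Abstract elementary classes\<close>

text \<open>A class of structures together with an ordering, as a pair.\<close>

type_synonym ('u, 'f, 'r) ordered_class =
  "('u, 'f, 'r) struct set \<times> ('u, 'f, 'r) struct rel"

definition limit_ordinal :: "'i rel \<Rightarrow> bool" where
  "limit_ordinal r \<longleftrightarrow>
     Well_order r \<and> Field r \<noteq> {} \<and> (\<forall>i \<in> Field r. \<exists>j \<in> Field r. j \<noteq> i \<and> (i, j) \<in> r)"

definition LST_axiom ::
  "('f, 'r) vocab \<Rightarrow> ('u, 'f, 'r) ordered_class \<Rightarrow> 'u rel \<Rightarrow> bool" where
  "LST_axiom \<tau> \<K> l \<longleftrightarrow>
     Card_order l \<and> set_sized (Field l) \<and> |symbols \<tau>| +c natLeq \<le>o l \<and>
     (\<forall>N \<in> fst \<K>. \<forall>A \<subseteq> univ N. \<exists>M \<in> fst \<K>.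
        A \<subseteq> univ M \<and> (M, N) \<in> snd \<K> \<and> |univ M| \<le>o |A| +c l)"

definition AEC :: "('f, 'r) vocab \<Rightarrow> ('u, 'f, 'r) ordered_class \<Rightarrow> bool" where
  "AEC \<tau> \<K> \<longleftrightarrow> (case \<K> of (K, le) \<Rightarrow>
     (\<forall>M \<in> K. is_structure M \<and> voc M = \<tau>) \<and>
     partial_order_on K le \<and>
     (\<forall>M N. (M, N) \<in> le \<longrightarrow> substructure M N) \<and>
     (\<forall>h M M'. M \<in> K \<and> iso h M M' \<longrightarrow> M' \<in> K) \<and>
     (\<forall>h M N M' N'. (M, N) \<in> le \<and> iso h N N' \<and> iso h M M' \<longrightarrow> (M', N') \<in> le) \<and>
     \<comment> \<open>coherence\<close>
     (\<forall>M0 \<in> K. \<forall>M1 \<in> K. \<forall>M2 \<in> K.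
        substructure M0 M1 \<and> (M1, M2) \<in> le \<and> (M0, M2) \<in> le \<longrightarrow> (M0, M1) \<in> le) \<and>
     \<comment> \<open>chain axioms; the least index \<open>z\<close> is the \<open>0\<close> of the limit ordinal \<open>r\<close>\<close>
     (\<forall>(r :: 'u rel) M U z.
        limit_ordinal r \<and> set_sized (Field r) \<and>
        z \<in> Field r \<and> (\<forall>i \<in> Field r. (z, i) \<in> r) \<and>
        (\<forall>i \<in> Field r. M i \<in> K) \<and> (\<forall>i j. (i, j) \<in> r \<longrightarrow> (M i, M j) \<in> le) \<and>
        is_union (Field r) M U \<longrightarrow>
          U \<in> K \<and> (M z, U) \<in> le \<and>
          (\<forall>N \<in> K. (\<forall>i \<in> Field r. (M i, N) \<in> le) \<longrightarrow> (U, N) \<in> le)) \<and>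
     (\<exists>l. LST_axiom \<tau> \<K> l))"

text \<open>Unique up to isomorphism of cardinals (which are particular well-orders).\<close>

definition LS :: "('f, 'r) vocab \<Rightarrow> ('u, 'f, 'r) ordered_class \<Rightarrow> 'u rel" where
  "LS \<tau> \<K> = (SOME l. LST_axiom \<tau> \<K> l \<and> (\<forall>l'. LST_axiom \<tau> \<K> l' \<longrightarrow> l \<le>o l'))"

definition cl ::
  "('u, 'f, 'r) ordered_class \<Rightarrow> ('u, 'f, 'r) struct \<Rightarrow> 'u set \<Rightarrow> ('u, 'f, 'r) struct" where
  "cl \<K> N A = restrict N (\<Inter>{univ N0 | N0. (N0, N) \<in> snd \<K> \<and> A \<subseteq> univ N0})"

definition has_intersections :: "('u, 'f, 'r) ordered_class \<Rightarrow> bool" where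
  "has_intersections \<K> \<longleftrightarrow> (\<forall>N \<in> fst \<K>. \<forall>A \<subseteq> univ N. (cl \<K> N A, N) \<in> snd \<K>)"

definition pointed :: "('u, 'f, 'r) ordered_class \<Rightarrow> ('u list \<times> ('u, 'f, 'r) struct) set" where
  "pointed \<K> = {(a, M). M \<in> fst \<K> \<and> set a \<subseteq> univ M}"

definition pointed_equiv :: "('u, 'f, 'r) ordered_class \<Rightarrow> ('u list \<times> ('u, 'f, 'r) struct) rel" where
  "pointed_equiv \<K> = {((a, M), (b, N)).
     (a, M) \<in> pointed \<K> \<and> (b, N) \<in> pointed \<K> \<and>
     (\<exists>h. iso h (cl \<K> M (set a)) (cl \<K> N (set b)) \<and> map h a = b)}"

definition D_set :: "('u, 'f, 'r) ordered_class \<Rightarrow> ('u list \<times> ('u, 'f, 'r) struct) set set" where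
  "D_set \<K> = pointed \<K> // pointed_equiv \<K>"

definition functorial_expansion ::
  "('f, 'r) vocab \<Rightarrow> ('u, 'f, 'r) ordered_class \<Rightarrow>
   ('f, 'r) vocab \<Rightarrow> ('u, 'f, 'r) ordered_class \<Rightarrow> bool" where
  "functorial_expansion \<tau> \<K> \<tau>' \<K>' \<longleftrightarrow>
     subvocab \<tau> \<tau>' \<and>
     (\<forall>M \<in> fst \<K>'. is_structure M \<and> voc M = \<tau>') \<and>
     bij_betw (reduct \<tau>) (fst \<K>') (fst \<K>) \<and>
     (\<forall>M \<in> fst \<K>'. \<forall>N \<in> fst \<K>'. \<forall>h. iso h (reduct \<tau> M) (reduct \<tau> N) \<longrightarrow> iso h M N) \<and>
     (\<forall>M \<in> fst \<K>'. \<forall>N \<in> fst \<K>'. (reduct \<tau> M, reduct \<tau> N) \<in> snd \<K> \<longrightarrow> substructure M N) \<and>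
     snd \<K>' = {(M, N). M \<in> fst \<K>' \<and> N \<in> fst \<K>' \<and> (reduct \<tau> M, reduct \<tau> N) \<in> snd \<K>}"


section \<open>Structural logic\<close>

datatype 'f tm = Var nat | Fn 'f "'f tm list"

text \<open>
  Conjunctions and disjunctions are taken over families indexed by a subset (the domain of the
  partial map) of the type \<open>'l\<close>; \<open>QStruct M A x \<phi> ys \<psi>s\<close> binds \<open>x\<close> in
  \<open>\<phi>\<close> and, for each \<open>i\<close>, \<open>ys ! i\<close> in \<open>\<psi>s ! i\<close>. The vocabulary
  of \<open>M\<close> is part of \<open>M\<close>.
\<close>

datatype ('f, 'r, 'k, 'l) fm =
    Eq "'f tm" "'f tm"
  | Rel 'r "'f tm list"
  | Neg "('f, 'r, 'k, 'l) fm"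
  | Conj "'l \<Rightarrow> ('f, 'r, 'k, 'l) fm option"
  | Disj "'l \<Rightarrow> ('f, 'r, 'k, 'l) fm option"
  | All nat "('f, 'r, 'k, 'l) fm"
  | Ex nat "('f, 'r, 'k, 'l) fm"
  | QStruct "('k, 'f, 'r) struct" "'k set list" nat "('f, 'r, 'k, 'l) fm"
      "nat list" "('f, 'r, 'k, 'l) fm list"

primrec tm_vars :: "'f tm \<Rightarrow> nat set" where
  "tm_vars (Var v) = {v}"
| "tm_vars (Fn g ts) = \<Union>(set (map tm_vars ts))"

primrec tm_val :: "('u, 'f, 'r) struct \<Rightarrow> (nat \<Rightarrow> 'u) \<Rightarrow> 'f tm \<Rightarrow> 'u" where
  "tm_val N e (Var v) = e v"
| "tm_val N e (Fn g ts) = fint N g (map (tm_val N e) ts)"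

primrec fv :: "('f, 'r, 'k, 'l) fm \<Rightarrow> nat set" where
  "fv (Eq s t) = tm_vars s \<union> tm_vars t"
| "fv (Rel R ts) = \<Union>(tm_vars ` set ts)"
| "fv (Neg \<phi>) = fv \<phi>"
| "fv (Conj F) = \<Union>(ran (map_option fv \<circ> F))"
| "fv (Disj F) = \<Union>(ran (map_option fv \<circ> F))"
| "fv (All v \<phi>) = fv \<phi> - {v}"
| "fv (Ex v \<phi>) = fv \<phi> - {v}"
| "fv (QStruct M A x \<phi> ys \<psi>s) =
     (fv \<phi> - {x}) \<union> (\<Union>(y, V) \<in> set (zip ys (map fv \<psi>s)). V - {y})"

text \<open>
  Assignments are total functions into the type \<open>'u\<close>; only their values at the free variables
  matter, and these are meant to lie in \<open>univ N\<close>. So sentences make sense also in empty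
  structures.
\<close>

primrec sat :: "('u, 'f, 'r) struct \<Rightarrow> ('f, 'r, 'k, 'l) fm \<Rightarrow> (nat \<Rightarrow> 'u) \<Rightarrow> bool" where
  "sat N (Eq s t) = (\<lambda>e. tm_val N e s = tm_val N e t)"
| "sat N (Rel R ts) = (\<lambda>e. map (tm_val N e) ts \<in> rint N R)"
| "sat N (Neg \<phi>) = (\<lambda>e. \<not> sat N \<phi> e)"
| "sat N (Conj F) = (\<lambda>e. \<forall>P \<in> ran (map_option (sat N) \<circ> F). P e)"
| "sat N (Disj F) = (\<lambda>e. \<exists>P \<in> ran (map_option (sat N) \<circ> F). P e)"
| "sat N (All v \<phi>) = (\<lambda>e. \<forall>b \<in> univ N. sat N \<phi> (e(v := b)))"
| "sat N (Ex v \<phi>) = (\<lambda>e. \<exists>b \<in> univ N. sat N \<phi> (e(v := b)))"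
| "sat N (QStruct M A x \<phi> ys \<psi>s) = (\<lambda>e.
     let P = {b \<in> univ N. sat N \<phi> (e(x := b))};
         Q = (\<lambda>i. {b \<in> univ N. (map (sat N) \<psi>s ! i) (e(ys ! i := b))})
     in (\<forall>i < length \<psi>s. Q i \<subseteq> P) \<and>
        (\<exists>N0 h. substructure N0 (reduct (voc M) N) \<and> univ N0 = P \<and> iso h N0 M \<and>
           (\<forall>i < length \<psi>s. h ` Q i = A ! i)))"

definition def_set ::
  "('u, 'f, 'r) struct \<Rightarrow> ('f, 'r, 'k, 'l) fm \<Rightarrow> nat \<Rightarrow> (nat \<Rightarrow> 'u) \<Rightarrow> 'u set" where
  "def_set N \<phi> x e = {b \<in> univ N. sat N \<phi> (e(x := b))}"

inductive_set terms :: "('f, 'r) vocab \<Rightarrow> 'f tm set" for \<tau> where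
  "Var v \<in> terms \<tau>"
| "funs \<tau> g = Some (length ts) \<Longrightarrow> \<forall>t \<in> set ts. t \<in> terms \<tau> \<Longrightarrow> Fn g ts \<in> terms \<tau>"

inductive_set atomic_fms :: "('f, 'r) vocab \<Rightarrow> ('f, 'r, 'k, 'l) fm set" for \<tau> where
  "s \<in> terms \<tau> \<Longrightarrow> t \<in> terms \<tau> \<Longrightarrow> Eq s t \<in> atomic_fms \<tau>"
| "rels \<tau> R = Some (length ts) \<Longrightarrow> \<forall>t \<in> set ts. t \<in> terms \<tau> \<Longrightarrow> Rel R ts \<in> atomic_fms \<tau>"

text \<open>
  The formulas of $\mathbb{L}^{\kappa\mbox{-struct}}_{\mu,\omega}(\tau)$. The cardinals
  \<open>\<kappa>\<close> and \<open>\<mu>\<close> are well-orders on the types \<open>'k\<close> and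
  \<open>'l\<close>. As an ordinal is the set of its predecessors, the ordinals below \<open>\<kappa>\<close> are
  the proper initial segments of \<open>\<kappa>\<close>.
\<close>

inductive_set struct_logic ::
  "'k rel \<Rightarrow> 'l rel \<Rightarrow> ('f, 'r) vocab \<Rightarrow> ('f, 'r, 'k, 'l) fm set" for \<kappa> \<mu> \<tau> where
  atomic: "\<phi> \<in> atomic_fms \<tau> \<Longrightarrow> \<phi> \<in> struct_logic \<kappa> \<mu> \<tau>"
| neg: "\<phi> \<in> struct_logic \<kappa> \<mu> \<tau> \<Longrightarrow> Neg \<phi> \<in> struct_logic \<kappa> \<mu> \<tau>"
| conj: "|dom F| <o \<mu> \<Longrightarrow> finite (fv (Conj F)) \<Longrightarrow> \<forall>\<phi> \<in> ran F. \<phi> \<in> struct_logic \<kappa> \<mu> \<tau> \<Longrightarrow>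
    Conj F \<in> struct_logic \<kappa> \<mu> \<tau>"
| disj: "|dom F| <o \<mu> \<Longrightarrow> finite (fv (Disj F)) \<Longrightarrow> \<forall>\<phi> \<in> ran F. \<phi> \<in> struct_logic \<kappa> \<mu> \<tau> \<Longrightarrow>
    Disj F \<in> struct_logic \<kappa> \<mu> \<tau>"
| all: "\<phi> \<in> struct_logic \<kappa> \<mu> \<tau> \<Longrightarrow> All v \<phi> \<in> struct_logic \<kappa> \<mu> \<tau>"
| ex: "\<phi> \<in> struct_logic \<kappa> \<mu> \<tau> \<Longrightarrow> Ex v \<phi> \<in> struct_logic \<kappa> \<mu> \<tau>"
| qstruct: "is_structure M \<Longrightarrow> subvocab (voc M) \<tau> \<Longrightarrow>
    \<alpha> \<in> Field \<kappa> \<Longrightarrow> univ M = underS \<kappa> \<alpha> \<Longrightarrow>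
    length A = length \<psi>s \<Longrightarrow> length ys = length \<psi>s \<Longrightarrow> \<forall>X \<in> set A. X \<subseteq> univ M \<Longrightarrow>
    \<phi> \<in> struct_logic \<kappa> \<mu> \<tau> \<Longrightarrow> \<forall>\<psi> \<in> set \<psi>s. \<psi> \<in> struct_logic \<kappa> \<mu> \<tau> \<Longrightarrow>
    QStruct M A x \<phi> ys \<psi>s \<in> struct_logic \<kappa> \<mu> \<tau>"

inductive qfree :: "('f, 'r, 'k, 'l) fm \<Rightarrow> bool" where
  "qfree (Eq s t)"
| "qfree (Rel R ts)"
| "qfree \<phi> \<Longrightarrow> qfree (Neg \<phi>)"
| "\<forall>\<phi> \<in> ran F. qfree \<phi> \<Longrightarrow> qfree (Conj F)"
| "\<forall>\<phi> \<in> ran F. qfree \<phi> \<Longrightarrow> qfree (Disj F)"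

text \<open>Well-formedness (in a given structural logic) is not part of this definition.\<close>

definition forall_Q_sentence :: "('f, 'r, 'k, 'l) fm \<Rightarrow> bool" where
  "forall_Q_sentence \<chi> \<longleftrightarrow> fv \<chi> = {} \<and>
     (\<exists>zs F S x \<phi> ys \<psi>s.
        \<chi> = foldr All zs (Disj F) \<and>
        ran F = {QStruct M A x \<phi> ys \<psi>s | M A. (M, A) \<in> S} \<and> S \<noteq> {} \<and>
        qfree \<phi> \<and> (\<forall>\<psi> \<in> set \<psi>s. qfree \<psi>))"

primrec immediate_subfms :: "('f, 'r, 'k, 'l) fm \<Rightarrow> ('f, 'r, 'k, 'l) fm set" where
  "immediate_subfms (Eq s t) = {}"
| "immediate_subfms (Rel R ts) = {}"
| "immediate_subfms (Neg \<phi>) = {\<phi>}"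
| "immediate_subfms (Conj F) = ran F"
| "immediate_subfms (Disj F) = ran F"
| "immediate_subfms (All v \<phi>) = {\<phi>}"
| "immediate_subfms (Ex v \<phi>) = {\<phi>}"
| "immediate_subfms (QStruct M A x \<phi> ys \<psi>s) = insert \<phi> (set \<psi>s)"

definition fragment ::
  "'k rel \<Rightarrow> 'l rel \<Rightarrow> ('f, 'r) vocab \<Rightarrow> ('f, 'r, 'k, 'l) fm set \<Rightarrow> bool" where
  "fragment \<kappa> \<mu> \<tau> F \<longleftrightarrow>
     F \<subseteq> struct_logic \<kappa> \<mu> \<tau> \<and> atomic_fms \<tau> \<subseteq> F \<and> (\<forall>\<phi> \<in> F. immediate_subfms \<phi> \<subseteq> F)"

definition smallest_fragment ::
  "'k rel \<Rightarrow> 'l rel \<Rightarrow> ('f, 'r) vocab \<Rightarrow> ('f, 'r, 'k, 'l) fm set \<Rightarrow> ('f, 'r, 'k, 'l) fm set" where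
  "smallest_fragment \<kappa> \<mu> \<tau> T = \<Inter>{F. fragment \<kappa> \<mu> \<tau> F \<and> T \<subseteq> F}"

definition elem_sub ::
  "('f, 'r, 'k, 'l) fm set \<Rightarrow> ('u, 'f, 'r) struct \<Rightarrow> ('u, 'f, 'r) struct \<Rightarrow> bool" where
  "elem_sub F N1 N2 \<longleftrightarrow> substructure N1 N2 \<and>
     (\<forall>\<phi> \<in> F. \<forall>e. e ` fv \<phi> \<subseteq> univ N1 \<longrightarrow> (sat N1 \<phi> e \<longleftrightarrow> sat N2 \<phi> e))"

definition elem_sub_star ::
  "'k rel \<Rightarrow> ('f, 'r, 'k, 'l) fm set \<Rightarrow> ('u, 'f, 'r) struct \<Rightarrow> ('u, 'f, 'r) struct \<Rightarrow> bool" where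
  "elem_sub_star \<kappa> F N1 N2 \<longleftrightarrow> elem_sub F N1 N2 \<and>
     (\<forall>M A x \<phi> ys \<psi>s e.
        QStruct M A x \<phi> ys \<psi>s \<in> F \<and> e ` fv (QStruct M A x \<phi> ys \<psi>s) \<subseteq> univ N1 \<and>
        |def_set N1 \<phi> x e| <o \<kappa> \<longrightarrow>
          def_set N1 \<phi> x e = def_set N2 \<phi> x e \<and>
          (\<forall>i < length \<psi>s. def_set N1 (\<psi>s ! i) (ys ! i) e = def_set N2 (\<psi>s ! i) (ys ! i) e))"

definition models ::
  "('f, 'r) vocab \<Rightarrow> ('f, 'r, 'k, 'l) fm set \<Rightarrow> ('u, 'f, 'r) struct set" where
  "models \<tau> T = {N. is_structure N \<and> voc N = \<tau> \<and> (\<forall>\<phi> \<in> T. \<forall>e. sat N \<phi> e)}"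

definition Mod ::
  "'k rel \<Rightarrow> ('f, 'r) vocab \<Rightarrow> ('f, 'r, 'k, 'l) fm set \<Rightarrow> ('f, 'r, 'k, 'l) fm set \<Rightarrow>
   ('u, 'f, 'r) ordered_class" where
  "Mod \<kappa> \<tau> F T =
     (models \<tau> T, {(M, N). M \<in> models \<tau> T \<and> N \<in> models \<tau> T \<and> elem_sub_star \<kappa> F M N})"

end

theory Submission
  imports Defs
begin

text \<open>
  Expand \<open>N \<in> K\<close> by interpreting \<open>E n\<close> as the relation ``\<open>b\<close> lies in the closure of
  \<open>a\<^sub>0, \<dots>, a\<^sub>n\<^sub>-\<^sub>1\<close>''. The \<open>n\<close>-th axiom says that for every \<open>n\<close>-tuple \<open>a\<close> the set
  \<open>E n(N, a)\<close> carries, with \<open>a\<close> marked, an isomorphic copy of one of the expanded closures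
  represented in \<open>D(K)\<close>. In a model, the sets \<open>E n(N, a)\<close> are therefore members of the class,
  and each of them computes the closures inside it correctly. If \<open>b\<close> lies in \<open>E n(N, a)\<close>, then
  \<open>E m(N, b) \<subseteq> E n(N, a)\<close>: an element \<open>c\<close> of the former can be compared with both
  sets inside the closure of the tuple \<open>c a b\<close>. So the model is a directed union of members of the
  class, and the chain axioms give that it is in the class and that \<open>E\<close> defines its closures.
\<close>

section \<open>Structures, substructures and isomorphisms\<close>

text \<open>A formula can prescribe a structure only up to isomorphism, so the axioms carry two
  further pieces of data. The prescribed structures are in the full vocabulary: a copy inside a
  model brings its own closure relations, and these agree with those of the model because the copy
  is a substructure. The entries of the tuple are marked by singletons, since otherwise nothing
  would say that the copy is the closure of this very tuple. Both cardinals have their origin here: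
  a finite set has a closure of size at most LS(K), so its copy lives on an ordinal below the
  successor of LS(K); and the disjuncts come from the classes in D(K) and one more pair. An obstacle
  is that the chain axioms speak of well-ordered chains, while the closures of finite tuples form
  only a directed system. As to the orderings, preservation of formulas would fix a closure only up
  to isomorphism, and an infinite closure may be isomorphic to a proper part of itself; the clause
  on defined sets in the starred relation makes the smaller model keep its closures.\<close>

definition closed_under :: "('u, 'f, 'r) struct \<Rightarrow> 'u set \<Rightarrow> bool" where
  "closed_under N X \<longleftrightarrow>
     (\<forall>g n. funs (voc N) g = Some n \<longrightarrow> (\<forall>xs \<in> tuples n X. fint N g xs \<in> X))"

lemma tuples_iff [simp]: "xs \<in> tuples n A \<longleftrightarrow> length xs = n \<and> set xs \<subseteq> A"
  by (simp add: tuples_def)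

lemma voc_restrict [simp]: "voc (restrict N X) = voc N"
  and univ_restrict [simp]: "univ (restrict N X) = X"
  by (simp_all add: restrict_def)

lemma voc_reduct [simp]: "voc (reduct \<sigma> N) = \<sigma>"
  and univ_reduct [simp]: "univ (reduct \<sigma> N) = univ N"
  by (simp_all add: reduct_def)

lemma set_sized_subset: "A \<subseteq> B \<Longrightarrow> set_sized B \<Longrightarrow> set_sized A"
  unfolding set_sized_def using card_of_mono1 ordLeq_ordLess_trans by blast

lemma structure_fint_closed:
  assumes "is_structure M" "funs (voc M) g = Some n" "length xs = n" "set xs \<subseteq> univ M"
  shows "fint M g xs \<in> univ M"
  using assms unfolding is_structure_def by (auto dest!: spec[of _ g])

lemma structure_fint_undefined:
  assumes "is_structure M" "\<And>n. funs (voc M) g = Some n \<Longrightarrow> length xs = n \<Longrightarrow> \<not> set xs \<subseteq> univ M"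
  shows "fint M g xs = undefined"
proof -
  have "case funs (voc M) g of
        Some n \<Rightarrow> if xs \<in> tuples n (univ M) then fint M g xs \<in> univ M else fint M g xs = undefined
      | None \<Rightarrow> fint M g xs = undefined"
    using assms(1) unfolding is_structure_def by blast
  then show ?thesis using assms(2) by (cases "funs (voc M) g") (auto split: if_splits)
qed

lemma structure_rintD:
  assumes "is_structure M" "xs \<in> rint M R"
  shows "rels (voc M) R = Some (length xs)" "set xs \<subseteq> univ M"
proof -
  have "case rels (voc M) R of
        Some n \<Rightarrow> rint M R \<subseteq> tuples n (univ M)
      | None \<Rightarrow> rint M R = {}"
    using assms(1) unfolding is_structure_def by blast
  then have "rels (voc M) R = Some (length xs) \<and> set xs \<subseteq> univ M"
    using assms(2) by (cases "rels (voc M) R") (auto simp: tuples_def)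
  then show "rels (voc M) R = Some (length xs)" "set xs \<subseteq> univ M" by auto
qed

lemma is_structureI:
  assumes "set_sized (univ M)"
    and "\<And>g n xs. funs (voc M) g = Some n \<Longrightarrow> length xs = n \<Longrightarrow> set xs \<subseteq> univ M \<Longrightarrow> fint M g xs \<in> univ M"
    and "\<And>g xs. (\<And>n. funs (voc M) g = Some n \<Longrightarrow> length xs = n \<Longrightarrow> \<not> set xs \<subseteq> univ M) \<Longrightarrow> fint M g xs = undefined"
    and "\<And>R xs. xs \<in> rint M R \<Longrightarrow> rels (voc M) R = Some (length xs) \<and> set xs \<subseteq> univ M"
  shows "is_structure M"
  unfolding is_structure_def
proof (intro conjI allI)
  show "set_sized (univ M)" by fact
next
  fix g xs
  show "case funs (voc M) g of
        Some n \<Rightarrow> if xs \<in> tuples n (univ M) then fint M g xs \<in> univ M else fint M g xs = undefined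
      | None \<Rightarrow> fint M g xs = undefined"
    using assms(2)[of g _ xs] assms(3)[of g xs] by (auto split: option.splits)
next
  fix R
  show "case rels (voc M) R of
        Some n \<Rightarrow> rint M R \<subseteq> tuples n (univ M)
      | None \<Rightarrow> rint M R = {}"
    using assms(4)[of _ R] by (auto split: option.splits)
qed

text \<open>The normalisation in \<open>is_structure\<close> fixes all values outside the proper
  domain, so agreement on it is literal equality.\<close>

lemma structure_eqI:
  assumes "is_structure M" "is_structure N" "voc M = voc N" "univ M = univ N"
    and "\<And>g xs. funs (voc M) g = Some (length xs) \<Longrightarrow> set xs \<subseteq> univ M \<Longrightarrow> fint M g xs = fint N g xs"
    and "\<And>R xs. rels (voc M) R = Some (length xs) \<Longrightarrow> set xs \<subseteq> univ M \<Longrightarrow> xs \<in> rint M R \<longleftrightarrow> xs \<in> rint N R"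
  shows "M = N"
proof (rule struct.expand, intro conjI)
  show "fint M = fint N"
  proof (intro ext)
    fix g xs
    show "fint M g xs = fint N g xs"
    proof (cases "funs (voc M) g = Some (length xs) \<and> set xs \<subseteq> univ M")
      case False
      then show ?thesis
        using assms(1-4) structure_fint_undefined[of M g xs] structure_fint_undefined[of N g xs] by auto
    qed (use assms(5) in blast)
  qed
  show "rint M = rint N"
  proof (intro ext set_eqI)
    fix R xs
    show "xs \<in> rint M R \<longleftrightarrow> xs \<in> rint N R"
      using assms(6)[of R xs] structure_rintD[OF assms(1)] structure_rintD[OF assms(2)] assms(3,4)
      by metis
  qed
qed (simp_all add: assms(3,4))

section \<open>Restrictions and reducts\<close>

lemma is_structure_restrict:
  assumes "is_structure N" "X \<subseteq> univ N"
  shows "is_structure (restrict N X) \<longleftrightarrow> closed_under N X"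
proof
  assume "is_structure (restrict N X)"
  then show "closed_under N X"
    using structure_fint_closed[of "restrict N X"] by (auto simp: closed_under_def restrict_def)
next
  assume cl: "closed_under N X"
  show "is_structure (restrict N X)"
  proof (rule is_structureI)
    show "set_sized (univ (restrict N X))"
      using assms set_sized_subset by (auto simp: is_structure_def)
  next
    fix g xs
    assume "\<And>n. funs (voc (restrict N X)) g = Some n \<Longrightarrow> length xs = n \<Longrightarrow> \<not> set xs \<subseteq> univ (restrict N X)"
    then show "fint (restrict N X) g xs = undefined"
      using structure_fint_undefined[OF assms(1), of g xs] by (auto simp: restrict_def)
  next
    fix R xs
    assume "xs \<in> rint (restrict N X) R"
    then show "rels (voc (restrict N X)) R = Some (length xs) \<and> set xs \<subseteq> univ (restrict N X)"
      using structure_rintD(1)[OF assms(1), of xs R] by (simp add: restrict_def)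
  qed (use cl in \<open>auto simp: closed_under_def restrict_def\<close>)
qed

lemma restrict_univ:
  assumes "is_structure N"
  shows "restrict N (univ N) = N"
proof (rule struct.expand, intro conjI)
  show "fint (restrict N (univ N)) = fint N"
    using structure_fint_undefined[OF assms] by (auto simp: restrict_def fun_eq_iff)
  show "rint (restrict N (univ N)) = rint N"
    using structure_rintD(2)[OF assms] by (auto simp: restrict_def fun_eq_iff)
qed simp_all

lemma restrict_restrict: "X \<subseteq> Y \<Longrightarrow> restrict (restrict N Y) X = restrict N X"
  by (auto simp: restrict_def fun_eq_iff)

lemma reduct_restrict: "reduct \<sigma> (restrict N X) = restrict (reduct \<sigma> N) X"
  by (auto simp: restrict_def reduct_def fun_eq_iff)

lemma reduct_self:
  assumes "is_structure N"
  shows "reduct (voc N) N = N"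
proof (rule struct.expand, intro conjI)
  have "funs (voc N) g = None \<Longrightarrow> fint N g xs = undefined" for g xs
    by (rule structure_fint_undefined[OF assms]) simp
  then show "fint (reduct (voc N) N) = fint N"
    by (auto simp: reduct_def fun_eq_iff domIff)
  have "xs \<in> rint N R \<Longrightarrow> R \<in> dom (rels (voc N))" for xs R
    using structure_rintD(1)[OF assms, of xs R] by blast
  then show "rint (reduct (voc N) N) = rint N"
    by (auto simp: reduct_def fun_eq_iff)
qed simp_all

lemma is_structure_reduct:
  assumes "is_structure N" "subvocab \<sigma> (voc N)"
  shows "is_structure (reduct \<sigma> N)"
proof -
  have f: "funs \<sigma> g = Some n \<Longrightarrow> funs (voc N) g = Some n"
    and r: "rels \<sigma> R = Some n \<Longrightarrow> rels (voc N) R = Some n" for g R n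
    using assms(2) by (auto simp: subvocab_def map_le_def dom_def)
  show ?thesis
  proof (rule is_structureI)
    fix g xs
    assume *: "\<And>n. funs (voc (reduct \<sigma> N)) g = Some n \<Longrightarrow> length xs = n \<Longrightarrow> \<not> set xs \<subseteq> univ (reduct \<sigma> N)"
    show "fint (reduct \<sigma> N) g xs = undefined"
    proof (cases "funs \<sigma> g")
      case (Some n)
      then show ?thesis using * f[OF Some] structure_fint_undefined[OF assms(1), of g xs]
        by (auto simp: reduct_def)
    qed (simp add: reduct_def domIff)
  next
    fix R xs
    assume "xs \<in> rint (reduct \<sigma> N) R"
    then show "rels (voc (reduct \<sigma> N)) R = Some (length xs) \<and> set xs \<subseteq> univ (reduct \<sigma> N)"
      using r structure_rintD[OF assms(1), of xs R] by (fastforce simp: reduct_def split: if_splits)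
  qed (use assms(1) f in \<open>auto simp: reduct_def dom_def is_structure_def structure_fint_closed[OF assms(1)]\<close>)
qed

text \<open>By normalisation a substructure is literally a restriction of the larger structure.
  Substructures of one fixed structure can then be handled as subsets of its universe.\<close>

lemma substructure_iff:
  "substructure M N \<longleftrightarrow>
     is_structure M \<and> is_structure N \<and> univ M \<subseteq> univ N \<and> M = restrict N (univ M)"
proof
  assume s: "substructure M N"
  then have *: "is_structure M" "is_structure N" "univ M \<subseteq> univ N" "voc M = voc N"
    by (auto simp: substructure_def)
  have "closed_under N (univ M)"
    unfolding closed_under_def using s structure_fint_closed[OF *(1)]
    by (auto simp: substructure_def) 
  then have "is_structure (restrict N (univ M))" using * is_structure_restrict by blast
  then have "M = restrict N (univ M)"
    using s by (intro structure_eqI) (auto simp: substructure_def restrict_def)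
  then show "is_structure M \<and> is_structure N \<and> univ M \<subseteq> univ N \<and> M = restrict N (univ M)"
    using * by blast
next
  assume "is_structure M \<and> is_structure N \<and> univ M \<subseteq> univ N \<and> M = restrict N (univ M)"
  then obtain X where M: "M = restrict N X" and "is_structure (restrict N X)" "is_structure N" "X \<subseteq> univ N"
    by metis
  then show "substructure M N"
    unfolding substructure_def M by (auto simp: restrict_def)
qed

section \<open>Isomorphisms and transport of structure\<close>

lemma isoD:
  assumes "iso h M N"
  shows "is_structure M" "is_structure N" "voc M = voc N" "bij_betw h (univ M) (univ N)"
    "inj_on h (univ M)" "h ` univ M = univ N"
  using assms by (auto simp: iso_def bij_betw_def)

lemma iso_fint:
  "iso h M N \<Longrightarrow> funs (voc M) g = Some (length xs) \<Longrightarrow> set xs \<subseteq> univ M \<Longrightarrow>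
    h (fint M g xs) = fint N g (map h xs)"
  by (simp add: iso_def)

lemma iso_rint:
  "iso h M N \<Longrightarrow> rels (voc M) R = Some (length xs) \<Longrightarrow> set xs \<subseteq> univ M \<Longrightarrow>
    map h xs \<in> rint N R \<longleftrightarrow> xs \<in> rint M R"
  by (simp add: iso_def)

lemma isoI:
  assumes "is_structure M" "is_structure N" "voc M = voc N" "bij_betw h (univ M) (univ N)"
    and "\<And>g xs. funs (voc M) g = Some (length xs) \<Longrightarrow> set xs \<subseteq> univ M \<Longrightarrow>
      h (fint M g xs) = fint N g (map h xs)"
    and "\<And>R xs. rels (voc M) R = Some (length xs) \<Longrightarrow> set xs \<subseteq> univ M \<Longrightarrow>
      map h xs \<in> rint N R \<longleftrightarrow> xs \<in> rint M R"
  shows "iso h M N"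
  using assms by (simp add: iso_def)

lemma iso_refl: "is_structure M \<Longrightarrow> iso (\<lambda>x. x) M M"
  by (rule isoI) (auto simp: bij_betw_def)

lemma iso_sym:
  assumes "iso h M N"
  shows "iso (inv_into (univ M) h) N M"
proof -
  let ?k = "inv_into (univ M) h"
  note st = isoD[OF assms]
  have hk: "h (?k y) = y" "?k y \<in> univ M" if "y \<in> univ N" for y
    using st(6) that by (auto simp: f_inv_into_f inv_into_into)
  have kh: "?k (h x) = x" if "x \<in> univ M" for x
    using st(5) that by simp
  have m: "map h (map ?k xs) = xs" "set (map ?k xs) \<subseteq> univ M" if "set xs \<subseteq> univ N" for xs
  proof -
    show "map h (map ?k xs) = xs" using that hk by (induction xs) auto
    show "set (map ?k xs) \<subseteq> univ M" using that hk(2) unfolding set_map by blast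
  qed
  show ?thesis
  proof (rule isoI)
    fix g xs assume g: "funs (voc N) g = Some (length xs)" and xs: "set xs \<subseteq> univ N"
    have "h (fint M g (map ?k xs)) = fint N g (map h (map ?k xs))"
      by (rule iso_fint[OF assms]) (use g st(3) m(2)[OF xs] in simp_all)
    moreover have "fint M g (map ?k xs) \<in> univ M"
      by (rule structure_fint_closed[OF st(1)]) (use g st(3) m(2)[OF xs] in simp_all)
    ultimately show "?k (fint N g xs) = fint M g (map ?k xs)"
      using m(1)[OF xs] kh by metis
  next
    fix R xs assume R: "rels (voc N) R = Some (length xs)" and xs: "set xs \<subseteq> univ N"
    have "map h (map ?k xs) \<in> rint N R \<longleftrightarrow> map ?k xs \<in> rint M R"
      by (rule iso_rint[OF assms]) (use R st(3) m(2)[OF xs] in simp_all)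
    then show "map ?k xs \<in> rint M R \<longleftrightarrow> xs \<in> rint N R"
      using m(1)[OF xs] by simp
  qed (use st bij_betw_inv_into in simp_all)
qed

lemma iso_trans:
  assumes "iso h M N" "iso k N P"
  shows "iso (\<lambda>x. k (h x)) M P"
proof (rule isoI)
  note st = isoD[OF assms(1)] isoD[OF assms(2)]
  show "bij_betw (\<lambda>x. k (h x)) (univ M) (univ P)"
    using bij_betw_trans[OF st(4,10)] by (simp add: o_def)
  have s: "set (map h xs) \<subseteq> univ N" if "set xs \<subseteq> univ M" for xs
    using that st(6) by auto
  have mm: "map (\<lambda>x. k (h x)) xs = map k (map h xs)" for xs
    by simp
  show "k (h (fint M g xs)) = fint P g (map (\<lambda>x. k (h x)) xs)"
    if "funs (voc M) g = Some (length xs)" "set xs \<subseteq> univ M" for g xs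
    unfolding mm using iso_fint[OF assms(1) that] iso_fint[OF assms(2) _ s[OF that(2)]] that(1) st(3)
    by simp
  show "map (\<lambda>x. k (h x)) xs \<in> rint P R \<longleftrightarrow> xs \<in> rint M R"
    if "rels (voc M) R = Some (length xs)" "set xs \<subseteq> univ M" for R xs
    unfolding mm using iso_rint[OF assms(1) that] iso_rint[OF assms(2) _ s[OF that(2)]] that(1) st(3)
    by simp
qed (use isoD[OF assms(1)] isoD[OF assms(2)] in simp_all)

lemma iso_restrict:
  assumes "iso h M N" "X \<subseteq> univ M" "closed_under M X"
  shows "iso h (restrict M X) (restrict N (h ` X))"
proof -
  note st = isoD[OF assms(1)]
  have "closed_under N (h ` X)"
    unfolding closed_under_def
  proof (intro allI impI ballI)
    fix g n ys assume g: "funs (voc N) g = Some n" and "ys \<in> tuples n (h ` X)"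
    then have n: "length ys = n" and "set ys \<subseteq> h ` X" by auto
    then have "ys \<in> map h ` lists X" by (auto simp flip: lists_image)
    then obtain xs where xs: "ys = map h xs" "set xs \<subseteq> X" by auto
    moreover have "fint M g xs \<in> X"
      using assms(3) g xs st(3) n by (auto simp: closed_under_def)
    ultimately show "fint N g ys \<in> h ` X"
      using iso_fint[OF assms(1), of g xs] g st(3) assms(2) n by force
  qed
  moreover have "h ` X \<subseteq> univ N" using st(6) assms(2) by blast
  ultimately have s: "is_structure (restrict N (h ` X))" "is_structure (restrict M X)"
    using st(1,2) assms(2,3) by (simp_all add: is_structure_restrict)
  have sub: "set xs \<subseteq> X \<Longrightarrow> set xs \<subseteq> univ M" for xs using assms(2) by blast
  show ?thesis
  proof (rule isoI)
    show "bij_betw h (univ (restrict M X)) (univ (restrict N (h ` X)))"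
      using st(5) assms(2) by (auto simp: bij_betw_def intro: inj_on_subset)
    show "h (fint (restrict M X) g xs) = fint (restrict N (h ` X)) g (map h xs)"
      if "funs (voc (restrict M X)) g = Some (length xs)" "set xs \<subseteq> univ (restrict M X)" for g xs
      using that iso_fint[OF assms(1), of g xs] sub[of xs] by (auto simp: restrict_def)
    show "map h xs \<in> rint (restrict N (h ` X)) R \<longleftrightarrow> xs \<in> rint (restrict M X) R"
      if "rels (voc (restrict M X)) R = Some (length xs)" "set xs \<subseteq> univ (restrict M X)" for R xs
      using that iso_rint[OF assms(1), of R xs] sub[of xs] by (auto simp: restrict_def)
  qed (use s st(3) in simp_all)
qed

text \<open>The structure is transported along the bijection. The two element types may differ: the
  purpose is to move a closure from \<open>'u\<close> to an ordinal, whose elements have type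
  \<open>'u set\<close>.\<close>

lemma ex_iso_on:
  assumes M: "is_structure M" and h: "bij_betw h (univ M) Y" and Y: "set_sized Y"
  shows "\<exists>N. iso h M N \<and> univ N = Y"
proof -
  define k where "k = inv_into (univ M) h"
  have kh: "k (h x) = x" if "x \<in> univ M" for x
    using h that by (simp add: bij_betw_def k_def)
  have k: "k y \<in> univ M" "h (k y) = y" if "y \<in> Y" for y
    using h that by (auto simp: bij_betw_def f_inv_into_f inv_into_into k_def)
  have hY: "h x \<in> Y" if "x \<in> univ M" for x using h that by (auto simp: bij_betw_def)
  have mk: "map k (map h xs) = xs" if "set xs \<subseteq> univ M" for xs
    using that kh by (induction xs) auto
  define N where "N = Struct (voc M) Y
    (\<lambda>g ys. if set ys \<subseteq> Y \<and> funs (voc M) g = Some (length ys) then h (fint M g (map k ys)) else undefined)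
    (\<lambda>R. {ys. set ys \<subseteq> Y \<and> map k ys \<in> rint M R})"
  have "is_structure N"
  proof (rule is_structureI)
    fix g n xs
    assume "funs (voc N) g = Some n" "length xs = n" "set xs \<subseteq> univ N"
    moreover from this have "set (map k xs) \<subseteq> univ M" using k by (auto simp: N_def)
    ultimately show "fint N g xs \<in> univ N"
      using structure_fint_closed[OF M, of g n "map k xs"] hY by (auto simp: N_def)
  next
    fix R xs assume "xs \<in> rint N R"
    then show "rels (voc N) R = Some (length xs) \<and> set xs \<subseteq> univ N"
      using structure_rintD[OF M, of "map k xs" R] by (auto simp: N_def)
  qed (use Y in \<open>auto simp: N_def\<close>)
  moreover have "set (map h xs) \<subseteq> Y" if "set xs \<subseteq> univ M" for xs using that hY by auto
  ultimately have "iso h M N"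
    using M h mk unfolding iso_def by (auto simp: N_def simp del: set_map map_map)
  then show ?thesis by (auto simp: N_def)
qed

text \<open>A bijection onto the universe of \<open>B\<close> makes only one structure on its domain
  isomorphic to \<open>B\<close>. This identifies a structure with the expansion of its reduct once
  the same map sends both to the same target.\<close>

lemma iso_unique_domain:
  assumes "iso h A B" "iso h A' B" "univ A = univ A'"
  shows "A = A'"
proof (rule structure_eqI)
  note st = isoD[OF assms(1)] isoD[OF assms(2)]
  show "voc A = voc A'" using st(3,9) by simp
  show "fint A g xs = fint A' g xs" if "funs (voc A) g = Some (length xs)" "set xs \<subseteq> univ A" for g xs
  proof (rule inj_onD[OF st(5)])
    show "h (fint A g xs) = h (fint A' g xs)"
      using iso_fint[OF assms(1), of g xs] iso_fint[OF assms(2), of g xs] that st(3,9) assms(3) by simp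
    show "fint A g xs \<in> univ A"
      by (rule structure_fint_closed[OF st(1) that(1) refl that(2)])
    show "fint A' g xs \<in> univ A"
      using structure_fint_closed[OF st(7), of g "length xs" xs] that st(3,9) assms(3) by simp
  qed
  show "xs \<in> rint A R \<longleftrightarrow> xs \<in> rint A' R" if "rels (voc A) R = Some (length xs)" "set xs \<subseteq> univ A" for R xs
    using iso_rint[OF assms(1), of R xs] iso_rint[OF assms(2), of R xs] that st(3,9) assms(3) by simp
qed (use assms(3) isoD[OF assms(1)] isoD[OF assms(2)] in simp_all)

lemma iso_reduct:
  assumes "iso h M N" "subvocab \<sigma> (voc M)"
  shows "iso h (reduct \<sigma> M) (reduct \<sigma> N)"
proof (rule isoI)
  note st = isoD[OF assms(1)]
  have f: "funs \<sigma> g = Some n \<Longrightarrow> funs (voc M) g = Some n"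
    and r: "rels \<sigma> R = Some n \<Longrightarrow> rels (voc M) R = Some n" for g R n
    using assms(2) by (auto simp: subvocab_def map_le_def dom_def)
  show "h (fint (reduct \<sigma> M) g xs) = fint (reduct \<sigma> N) g (map h xs)"
    if "funs (voc (reduct \<sigma> M)) g = Some (length xs)" "set xs \<subseteq> univ (reduct \<sigma> M)" for g xs
    using that iso_fint[OF assms(1), of g xs] f by (auto simp: reduct_def)
  show "map h xs \<in> rint (reduct \<sigma> N) R \<longleftrightarrow> xs \<in> rint (reduct \<sigma> M) R"
    if "rels (voc (reduct \<sigma> M)) R = Some (length xs)" "set xs \<subseteq> univ (reduct \<sigma> M)" for R xs
    using that iso_rint[OF assms(1), of R xs] r by (auto simp: reduct_def)
qed (use isoD[OF assms(1)] assms(2) is_structure_reduct[of M \<sigma>] is_structure_reduct[of N \<sigma>] in simp_all)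

section \<open>Closures in classes with intersections\<close>

locale aec_with_intersections =
  fixes \<tau> :: "('f, 'r) vocab" and \<K> :: "('u, 'f, 'r) ordered_class"
  assumes aec: "AEC \<tau> \<K>" and intersections: "has_intersections \<K>"
begin

abbreviation K :: "('u, 'f, 'r) struct set"
  where "K \<equiv> fst \<K>"

abbreviation le :: "('u, 'f, 'r) struct \<Rightarrow> ('u, 'f, 'r) struct \<Rightarrow> bool" (infix "\<preceq>" 50)
  where "M \<preceq> N \<equiv> (M, N) \<in> snd \<K>"

definition hull :: "('u, 'f, 'r) struct \<Rightarrow> 'u set \<Rightarrow> 'u set"
  where "hull N A = univ (cl \<K> N A)"

lemma aec_axioms:
  "(\<forall>M \<in> K. is_structure M \<and> voc M = \<tau>)"
  "partial_order_on K (snd \<K>)"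
  "\<And>M N. M \<preceq> N \<Longrightarrow> substructure M N"
  "\<And>h M M'. M \<in> K \<Longrightarrow> iso h M M' \<Longrightarrow> M' \<in> K"
  "\<And>h M N M' N'. M \<preceq> N \<Longrightarrow> iso h N N' \<Longrightarrow> iso h M M' \<Longrightarrow> M' \<preceq> N'"
  "\<And>M0 M1 M2. substructure M0 M1 \<Longrightarrow> M0 \<in> K \<Longrightarrow> M1 \<in> K \<Longrightarrow> M2 \<in> K \<Longrightarrow> M1 \<preceq> M2 \<Longrightarrow> M0 \<preceq> M2 \<Longrightarrow> M0 \<preceq> M1"
  "\<And>(r :: 'u rel) M U z.
        limit_ordinal r \<Longrightarrow> set_sized (Field r) \<Longrightarrow>
        z \<in> Field r \<Longrightarrow> \<forall>i \<in> Field r. (z, i) \<in> r \<Longrightarrow>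
        \<forall>i \<in> Field r. M i \<in> K \<Longrightarrow> \<forall>i j. (i, j) \<in> r \<longrightarrow> M i \<preceq> M j \<Longrightarrow>
        is_union (Field r) M U \<Longrightarrow>
          U \<in> K \<and> M z \<preceq> U \<and> (\<forall>N \<in> K. (\<forall>i \<in> Field r. M i \<preceq> N) \<longrightarrow> U \<preceq> N)"
  "\<exists>l. LST_axiom \<tau> \<K> l"
proof -
  obtain K' le' where \<K>: "\<K> = (K', le')" by fastforce
  note a = aec[unfolded AEC_def \<K> prod.case]
  show "(\<forall>M \<in> K. is_structure M \<and> voc M = \<tau>)"
    unfolding \<K> fst_conv snd_conv using a by (elim conjE) assumption
  show "partial_order_on K (snd \<K>)"
    unfolding \<K> fst_conv snd_conv using a by (elim conjE) assumption
  show "M \<preceq> N \<Longrightarrow> substructure M N" for M N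
    unfolding \<K> fst_conv snd_conv using a[THEN conjunct2, THEN conjunct2, THEN conjunct1] by blast
  show "M \<in> K \<Longrightarrow> iso h M M' \<Longrightarrow> M' \<in> K" for h M M'
    unfolding \<K> fst_conv snd_conv
    using a[THEN conjunct2, THEN conjunct2, THEN conjunct2, THEN conjunct1] by blast
  show "M \<preceq> N \<Longrightarrow> iso h N N' \<Longrightarrow> iso h M M' \<Longrightarrow> M' \<preceq> N'" for h M N M' N'
    unfolding \<K> fst_conv snd_conv
    using a[THEN conjunct2, THEN conjunct2, THEN conjunct2, THEN conjunct2, THEN conjunct1] by blast
  show "substructure M0 M1 \<Longrightarrow> M0 \<in> K \<Longrightarrow> M1 \<in> K \<Longrightarrow> M2 \<in> K \<Longrightarrow> M1 \<preceq> M2 \<Longrightarrow> M0 \<preceq> M2 \<Longrightarrow> M0 \<preceq> M1"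
    for M0 M1 M2
    unfolding \<K> fst_conv snd_conv
    using a[THEN conjunct2, THEN conjunct2, THEN conjunct2, THEN conjunct2, THEN conjunct2, THEN conjunct1]
    by blast
  show "U \<in> K \<and> M z \<preceq> U \<and> (\<forall>N \<in> K. (\<forall>i \<in> Field r. M i \<preceq> N) \<longrightarrow> U \<preceq> N)"
    if "limit_ordinal r" "set_sized (Field r)"
        "z \<in> Field r" "\<forall>i \<in> Field r. (z, i) \<in> r"
        "\<forall>i \<in> Field r. M i \<in> K" "\<forall>i j. (i, j) \<in> r \<longrightarrow> M i \<preceq> M j"
        "is_union (Field r) M U"
    for r :: "'u rel" and M U z
    using that unfolding \<K> fst_conv snd_conv
    by (intro a[THEN conjunct2, THEN conjunct2, THEN conjunct2, THEN conjunct2, THEN conjunct2,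
          THEN conjunct2, THEN conjunct1, rule_format]) blast
  show "\<exists>l. LST_axiom \<tau> \<K> l"
    unfolding \<K> using a by (elim conjE) assumption
qed

lemmas iso_mem_K = aec_axioms(4)
lemmas iso_le = aec_axioms(5)
lemmas chain_axiom = aec_axioms(7)

lemma K_structure [simp]: "M \<in> K \<Longrightarrow> is_structure M" "M \<in> K \<Longrightarrow> voc M = \<tau>"
  using aec_axioms(1) by auto

lemma le_in_K: "M \<preceq> N \<Longrightarrow> M \<in> K" "M \<preceq> N \<Longrightarrow> N \<in> K"
  using aec_axioms(2) by (auto simp: partial_order_on_def preorder_on_def)

lemma le_refl [simp]: "M \<in> K \<Longrightarrow> M \<preceq> M"
  using aec_axioms(2) by (auto simp: partial_order_on_def preorder_on_def refl_on_def)

lemma le_trans: "M \<preceq> N \<Longrightarrow> N \<preceq> P \<Longrightarrow> M \<preceq> P"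
  using aec_axioms(2) unfolding partial_order_on_def preorder_on_def by (meson transD)

lemma le_univ: "M \<preceq> N \<Longrightarrow> univ M \<subseteq> univ N"
  and le_eq_restrict: "M \<preceq> N \<Longrightarrow> M = restrict N (univ M)"
  using aec_axioms(3)[of M N] unfolding substructure_iff by auto

lemma le_restrict_subset: "restrict N X \<preceq> restrict N Y \<Longrightarrow> X \<subseteq> Y"
  using le_univ[of "restrict N X" "restrict N Y"] by simp

text \<open>Both structures are restrictions of \<open>N\<close>, so inclusion of the universes
  already yields the substructure premise of the coherence axiom.\<close>

lemma coherence:
  assumes "M0 \<preceq> N" "M1 \<preceq> N" "univ M0 \<subseteq> univ M1"
  shows "M0 \<preceq> M1"
proof (rule aec_axioms(6))
  have "M0 = restrict (restrict N (univ M1)) (univ M0)"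
    using le_eq_restrict[OF assms(1)] restrict_restrict[OF assms(3)] by metis
  then show "substructure M0 M1"
    unfolding substructure_iff
    using assms le_in_K[of M0 N] le_in_K[of M1 N] le_eq_restrict[OF assms(2)] by auto
qed (use assms le_in_K[of M0 N] le_in_K[of M1 N] in auto)

section \<open>Closure operator laws, absoluteness and isomorphism invariance\<close>

lemma hull_eq: "hull N A = \<Inter>{univ N0 | N0. N0 \<preceq> N \<and> A \<subseteq> univ N0}"
  by (simp add: hull_def cl_def)

lemma cl_eq: "cl \<K> N A = restrict N (hull N A)"
  by (simp add: hull_eq cl_def)

lemma hull_le:
  assumes "N \<in> K" "A \<subseteq> univ N"
  shows "restrict N (hull N A) \<preceq> N"
  using assms intersections by (simp add: cl_eq has_intersections_def)

lemma hull_extensive: "A \<subseteq> hull N A"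
  by (auto simp: hull_eq)

lemma hull_least: "N0 \<preceq> N \<Longrightarrow> A \<subseteq> univ N0 \<Longrightarrow> hull N A \<subseteq> univ N0"
  by (auto simp: hull_eq)

lemma hull_subset: "N \<in> K \<Longrightarrow> A \<subseteq> univ N \<Longrightarrow> hull N A \<subseteq> univ N"
  by (rule hull_least) simp_all

lemma hull_idem: "N \<in> K \<Longrightarrow> B \<subseteq> univ N \<Longrightarrow> A \<subseteq> hull N B \<Longrightarrow> hull N A \<subseteq> hull N B"
  using hull_least[OF hull_le, of N B A] by simp

lemma hull_mono: "N \<in> K \<Longrightarrow> B \<subseteq> univ N \<Longrightarrow> A \<subseteq> B \<Longrightarrow> hull N A \<subseteq> hull N B"
  using hull_idem[of N B A] hull_extensive[of B N] by (simp add: subset_trans)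

text \<open>Each closure takes part in the intersection that defines the other: the closure in
  \<open>M\<close> is below \<open>N\<close> by transitivity, and the closure in \<open>N\<close>,
  which lies inside \<open>M\<close>, is below \<open>M\<close> by coherence.\<close>

lemma hull_absolute:
  assumes "M \<preceq> N" "A \<subseteq> univ M"
  shows "hull M A = hull N A"
proof
  have A: "A \<subseteq> univ N" using le_univ assms by blast
  have "restrict N (hull N A) \<preceq> M"
    using hull_least[OF assms]
    by (intro coherence[OF _ assms(1)] hull_le le_in_K(2)[OF assms(1)] A) simp
  then show "hull M A \<subseteq> hull N A" using hull_least[of _ M A] hull_extensive by fastforce
  have "restrict M (hull M A) \<preceq> N"
    using hull_le[OF le_in_K(1) assms(2)] assms(1) le_trans by blast
  then show "hull N A \<subseteq> hull M A" using hull_least[of _ N A] hull_extensive by fastforce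
qed

lemma restrict_closed: "N \<in> K \<Longrightarrow> X \<subseteq> univ N \<Longrightarrow> restrict N X \<in> K \<Longrightarrow> closed_under N X"
  using is_structure_restrict[of N X] by simp

text \<open>The image of the closure is below \<open>N\<close> by isomorphism invariance of the
  ordering, so it takes part in the intersection. Applied to the inverse map as well, this gives
  equality.\<close>

lemma iso_hull_subset:
  assumes "iso h M N" "M \<in> K" "A \<subseteq> univ M"
  shows "hull N (h ` A) \<subseteq> h ` hull M A"
proof -
  have le: "restrict M (hull M A) \<preceq> M" by (rule hull_le[OF assms(2,3)])
  have "iso h (restrict M (hull M A)) (restrict N (h ` hull M A))"
    by (intro iso_restrict[OF assms(1)] hull_subset restrict_closed assms le_in_K(1)[OF le])
  then have "restrict N (h ` hull M A) \<preceq> N"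
    using iso_le[OF le assms(1)] by blast
  then show ?thesis
    using hull_least[of "restrict N (h ` hull M A)" N "h ` A"] hull_extensive[of A M] by auto
qed

lemma iso_hull:
  assumes "iso h M N" "M \<in> K" "A \<subseteq> univ M"
  shows "hull N (h ` A) = h ` hull M A"
proof
  show "hull N (h ` A) \<subseteq> h ` hull M A" by (rule iso_hull_subset[OF assms])
  let ?k = "inv_into (univ M) h"
  note st = isoD[OF assms(1)]
  have N: "N \<in> K" using iso_mem_K assms by blast
  have hA: "h ` A \<subseteq> univ N" using st(6) assms(3) by blast
  have "?k ` h ` A = A" using st(5) assms(3) by simp
  then have "hull M A \<subseteq> ?k ` hull N (h ` A)"
    using iso_hull_subset[OF iso_sym[OF assms(1)] N hA] by simp
  then have "h ` hull M A \<subseteq> h ` ?k ` hull N (h ` A)" by blast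
  also have "\<dots> = hull N (h ` A)"
    using hull_subset[OF N hA] st(6) by (simp add: image_image f_inv_into_f subset_iff cong: image_cong_simp)
  finally show "h ` hull M A \<subseteq> hull N (h ` A)" .
qed

end

section \<open>Directed unions\<close>

lemma finite_subset_chain:
  assumes r: "Well_order r" "Field r \<noteq> {}" and "finite F" "F \<subseteq> (\<Union>i\<in>Field r. Z i)"
    and mono: "\<And>i j. (i, j) \<in> r \<Longrightarrow> Z i \<subseteq> Z j"
  shows "\<exists>i\<in>Field r. F \<subseteq> Z i"
  using assms(3,4)
proof (induction F)
  case empty
  then show ?case using r(2) by auto
next
  case (insert x F)
  then obtain i j where ij: "i \<in> Field r" "F \<subseteq> Z i" "j \<in> Field r" "x \<in> Z j" by auto
  then have "(i, j) \<in> r \<or> (j, i) \<in> r"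
    using wo_rel.TOTALS[of r] r(1) by (auto simp: wo_rel_def)
  then show ?case using ij mono[of i j] mono[of j i] by blast
qed

lemma limit_ordinal_card_of:
  assumes "infinite B"
  shows "limit_ordinal |B|"
  unfolding limit_ordinal_def
proof (intro conjI ballI)
  show "Field |B| \<noteq> {}" using assms by (auto simp: Field_card_of)
  show "\<exists>j\<in>Field |B|. j \<noteq> i \<and> (i, j) \<in> |B|" if "i \<in> Field |B|" for i
    using infinite_Card_order_limit[of "|B|" i] assms that
    by (metis Field_card_of card_of_Card_order)
qed (simp add: card_of_Well_order)

context aec_with_intersections
begin

text \<open>The chain axiom compares the union only with the first member; the first conclusion
  extends this to all members. The second is smoothness, restated for restrictions of one
  structure.\<close>

lemma chain_of_restrictions:
  fixes r :: "'u rel"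
  assumes r: "limit_ordinal r" "set_sized (Field r)"
    and N: "is_structure N" "voc N = \<tau>" "\<And>i. i \<in> Field r \<Longrightarrow> Z i \<subseteq> univ N"
    and le: "\<And>i j. (i, j) \<in> r \<Longrightarrow> restrict N (Z i) \<preceq> restrict N (Z j)"
  defines "U \<equiv> \<Union>i\<in>Field r. Z i"
  shows "i \<in> Field r \<Longrightarrow> restrict N (Z i) \<preceq> restrict N U"
    and "(\<And>i. i \<in> Field r \<Longrightarrow> restrict N (Z i) \<preceq> P) \<Longrightarrow> restrict N U \<preceq> P"
proof -
  have wo: "Well_order r" "Field r \<noteq> {}" using r(1) by (auto simp: limit_ordinal_def)
  then interpret wo_rel r by (simp add: wo_rel_def)
  have mono: "Z i \<subseteq> Z j" if "(i, j) \<in> r" for i j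
    using le[OF that] le_restrict_subset by blast
  have K: "restrict N (Z i) \<in> K" if "i \<in> Field r" for i
    using le[of i i] le_in_K(1) REFL that by (auto simp: refl_on_def)
  have closed: "closed_under N (Z i)" if "i \<in> Field r" for i
    using K[OF that] is_structure_restrict[OF N(1) N(3)[OF that]] by simp
  have UN: "U \<subseteq> univ N" using N(3) by (auto simp: U_def)
  have "closed_under N U"
    unfolding closed_under_def
  proof (intro allI impI ballI)
    fix g n xs assume g: "funs (voc N) g = Some n" "xs \<in> tuples n U"
    then obtain i where i: "i \<in> Field r" "set xs \<subseteq> Z i"
      using finite_subset_chain[OF wo, of "set xs" Z] mono by (auto simp: U_def)
    then have "fint N g xs \<in> Z i" using closed[OF i(1)] g by (simp add: closed_under_def)
    then show "fint N g xs \<in> U" using i(1) by (auto simp: U_def)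
  qed
  then have U: "is_structure (restrict N U)" using is_structure_restrict[OF N(1) UN] by simp
  obtain z where z: "z \<in> Field r" "\<forall>i\<in>Field r. (z, i) \<in> r"
    using minim_in[of "Field r"] minim_least[of "Field r"] wo(2) by blast
  show le_U: "restrict N (Z i) \<preceq> restrict N U" if i: "i \<in> Field r" for i
  proof -
    \<comment> \<open>Every member not above \<open>i\<close> is replaced by the \<open>i\<close>-th
      one. The new chain starts at \<open>Z i\<close> and has the same union, so the chain axiom
      gives the comparison for \<open>i\<close>.\<close>
    define W where "W j = Z (if (i, j) \<in> r then j else i)" for j
    have W: "restrict N (W j) \<preceq> restrict N (W k)" if "(j, k) \<in> r" for j k
      using that TRANS i K[OF i] le by (auto simp: W_def dest: transD)
    have Wi: "W j = Z j \<or> W j = Z i" for j by (auto simp: W_def)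
    have Wz: "W z = Z i"
      using z i ANTISYM by (auto simp: W_def dest: antisymD)
    have "restrict N (W z) \<preceq> restrict N U"
    proof (rule chain_axiom[OF r z, THEN conjunct2, THEN conjunct1])
      show "\<forall>j\<in>Field r. restrict N (W j) \<in> K"
        using K i by (auto simp: W_def)
      show "\<forall>j k. (j, k) \<in> r \<longrightarrow> restrict N (W j) \<preceq> restrict N (W k)"
        using W by blast
      have "(\<Union>j\<in>Field r. W j) = U"
      proof
        show "(\<Union>j\<in>Field r. W j) \<subseteq> U" using i by (auto simp: W_def U_def split: if_splits)
        show "U \<subseteq> (\<Union>j\<in>Field r. W j)"
        proof
          fix x assume "x \<in> U"
          then obtain j where j: "j \<in> Field r" "x \<in> Z j" by (auto simp: U_def)
          show "x \<in> (\<Union>j\<in>Field r. W j)"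
          proof (cases "(i, j) \<in> r")
            case False
            then have "(j, i) \<in> r" using TOTALS i j by blast
            then show ?thesis using mono[of j i] j z Wz by blast
          qed (use j in \<open>auto simp: W_def\<close>)
        qed
      qed
      moreover have "substructure (restrict N (W j)) (restrict N U)" if "j \<in> Field r" for j
      proof -
        have "W j \<subseteq> U" using that i by (auto simp: W_def U_def)
        moreover have "is_structure (restrict N (W j))" using K i that by (auto simp: W_def)
        ultimately show ?thesis using U by (simp add: substructure_iff restrict_restrict)
      qed
      ultimately show "is_union (Field r) (\<lambda>j. restrict N (W j)) (restrict N U)"
        using U by (simp add: is_union_def)
    qed
    then show ?thesis by (simp add: Wz)
  qed
  show "restrict N U \<preceq> P" if P: "\<And>i. i \<in> Field r \<Longrightarrow> restrict N (Z i) \<preceq> P"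
  proof -
    have "is_union (Field r) (\<lambda>j. restrict N (Z j)) (restrict N U)"
      unfolding is_union_def using U le_U aec_axioms(3) by (auto simp: U_def)
    from chain_axiom[OF r z _ _ this] show ?thesis
      using K le P le_in_K(2) z(1) by blast
  qed
qed

text \<open>\<open>C\<close> is meant to be meaningful on finite sets only; an infinite
  \<open>A\<close> is reached through its finite subsets.\<close>

definition finitary_closure :: "('u set \<Rightarrow> 'u set) \<Rightarrow> 'u set \<Rightarrow> 'u set"
  where "finitary_closure C A = \<Union>{C F | F. finite F \<and> F \<subseteq> A}"

lemma finitary_closure_mono: "A \<subseteq> B \<Longrightarrow> finitary_closure C A \<subseteq> finitary_closure C B"
  by (auto simp: finitary_closure_def)

lemma finitary_closure_least:
  "(\<And>F. finite F \<Longrightarrow> F \<subseteq> A \<Longrightarrow> C F \<subseteq> D) \<Longrightarrow> finitary_closure C A \<subseteq> D"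
  by (auto simp: finitary_closure_def)

text \<open>Induction on the cardinality of \<open>B\<close>: an infinite \<open>B\<close> is the union of the initial segments
  of a well-order of type \<open>|B|\<close>, all of which are smaller than \<open>B\<close>.\<close>

lemma directed_union_le:
  assumes N: "is_structure N" "voc N = \<tau>"
    and C: "\<And>F. finite F \<Longrightarrow> F \<subseteq> univ N \<Longrightarrow> C F \<subseteq> univ N"
    and le: "\<And>F G. finite G \<Longrightarrow> F \<subseteq> G \<Longrightarrow> G \<subseteq> univ N \<Longrightarrow> restrict N (C F) \<preceq> restrict N (C G)"
    and "A \<subseteq> B" "B \<subseteq> univ N"
  shows "restrict N (finitary_closure C A) \<preceq> restrict N (finitary_closure C B)"
  using assms(5,6)
proof (induction B arbitrary: A rule: wf_induct[OF wf_inv_image[OF wf_ordLess, of card_of]])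
  case (1 B)
  let ?D = "\<lambda>A. restrict N (finitary_closure C A)"
  have IH: "?D X \<preceq> ?D Y" if "|Y| <o |B|" "X \<subseteq> Y" "Y \<subseteq> univ N" for X Y
    using 1(1) that by (simp add: inv_image_def)
  have sub: "finitary_closure C X \<subseteq> univ N" if "X \<subseteq> univ N" for X
    using C that by (intro finitary_closure_least) auto
  show ?case
  proof (cases "finite B")
    case True
    \<comment> \<open>A finite set is the largest of its own finite subsets, so by monotonicity of
      \<open>C\<close> the union is its last term.\<close>
    have eq: "finitary_closure C X = C X" if "X \<subseteq> B" for X
    proof -
      have "C F \<subseteq> C X" if "F \<subseteq> X" for F
        using le[of X F] le_restrict_subset that \<open>X \<subseteq> B\<close> True 1(3)
        by (meson finite_subset order_trans)
      moreover have "finite X" using that True finite_subset by blast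
      ultimately show ?thesis unfolding finitary_closure_def by blast
    qed
    show ?thesis using eq[OF 1(2)] eq[of B] le[OF True 1(2,3)] by simp
  next
    case False
    let ?r = "|B|"
    let ?S = "underS ?r"
    have lim: "limit_ordinal ?r" by (rule limit_ordinal_card_of[OF False])
    have wo: "Well_order ?r" "Field ?r \<noteq> {}" using lim by (auto simp: limit_ordinal_def)
    have ss: "set_sized (Field ?r)"
      using N(1) set_sized_subset[OF 1(3)] by (simp add: is_structure_def Field_card_of)
    have S_mono: "?S i \<subseteq> ?S j" if "(i, j) \<in> ?r" for i j
      using that wo(1) underS_incr[of ?r i j] by (auto simp: order_on_defs)
    have S_less: "|?S i| <o |B|" "?S i \<subseteq> B" if "i \<in> B" for i
      using that card_of_underS[OF card_of_Card_order, of i B] Order_Relation.underS_Field[of ?r]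
      by (simp_all add: Field_card_of)
    have S_union: "(\<Union>i\<in>B. ?S i) = B"
    proof
      show "(\<Union>i\<in>B. ?S i) \<subseteq> B" using S_less by blast
      show "B \<subseteq> (\<Union>i\<in>B. ?S i)"
      proof
        fix x assume "x \<in> B"
        then obtain j where "j \<in> B" "j \<noteq> x" "(x, j) \<in> ?r"
          using lim unfolding limit_ordinal_def Field_card_of by blast
        then show "x \<in> (\<Union>i\<in>B. ?S i)" by (auto simp: underS_def)
      qed
    qed
    have union: "(\<Union>i\<in>Field ?r. finitary_closure C (X \<inter> ?S i)) = finitary_closure C X" if "X \<subseteq> B" for X
    proof
      show "(\<Union>i\<in>Field ?r. finitary_closure C (X \<inter> ?S i)) \<subseteq> finitary_closure C X"
        by (intro UN_least finitary_closure_mono) blast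
      show "finitary_closure C X \<subseteq> (\<Union>i\<in>Field ?r. finitary_closure C (X \<inter> ?S i))"
      proof
        fix x assume "x \<in> finitary_closure C X"
        then obtain F where F: "finite F" "F \<subseteq> X" "x \<in> C F" by (auto simp: finitary_closure_def)
        then have "F \<subseteq> B" using that by blast
        then obtain i where "i \<in> B" "F \<subseteq> ?S i"
          using finite_subset_chain[OF wo F(1), of ?S] S_mono S_union by (auto simp: Field_card_of)
        then show "x \<in> (\<Union>i\<in>Field ?r. finitary_closure C (X \<inter> ?S i))"
          using F by (auto simp: finitary_closure_def Field_card_of)
      qed
    qed
    \<comment> \<open>Both sets lie in the initial segment of \<open>j\<close>, which is smaller
      than \<open>B\<close>, so the induction hypothesis applies. It is used within
      \<open>B\<close>, within \<open>A\<close>, and from \<open>A\<close> to \<open>B\<close> at a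
      common index.\<close>
    have step: "?D (X \<inter> ?S i) \<preceq> ?D (Y \<inter> ?S j)" if "X \<subseteq> Y" "(i, j) \<in> ?r" for X Y i j
    proof (rule IH)
      have j: "j \<in> B" using that(2) by (metis FieldI2 Field_card_of)
      have "|Y \<inter> ?S j| \<le>o |?S j|" by (simp add: card_of_mono1)
      then show "|Y \<inter> ?S j| <o |B|" using S_less(1)[OF j] ordLeq_ordLess_trans by blast
      show "Y \<inter> ?S j \<subseteq> univ N" using S_less(2)[OF j] 1(3) by blast
      show "X \<inter> ?S i \<subseteq> Y \<inter> ?S j" using that(1) S_mono[OF that(2)] by blast
    qed
    have refl: "(i, i) \<in> ?r" if "i \<in> B" for i
      using wo(1) that by (auto simp: order_on_defs refl_on_def Field_card_of)
    have subN: "finitary_closure C (X \<inter> ?S i) \<subseteq> univ N" if "X \<subseteq> B" for X i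
      using sub[of "X \<inter> ?S i"] that 1(3) by blast
    \<comment> \<open>The approximations to \<open>B\<close> lie below the union for
      \<open>B\<close>, hence so do the approximations to \<open>A\<close>; smoothness passes this
      on to their union.\<close>
    have "?D (B \<inter> ?S i) \<preceq> ?D B" if "i \<in> B" for i
      using chain_of_restrictions(1)[OF lim ss N, of "\<lambda>i. finitary_closure C (B \<inter> ?S i)" i]
        subN[of B] step[of B B] union[of B] that by (simp add: Field_card_of)
    then have "?D (A \<inter> ?S i) \<preceq> ?D B" if "i \<in> B" for i
      using step[OF 1(2) refl[OF that]] le_trans that by blast
    then show ?thesis
      using chain_of_restrictions(2)[OF lim ss N, of "\<lambda>i. finitary_closure C (A \<inter> ?S i)" "?D B"]
        subN[OF 1(2)] step[of A A] union[OF 1(2)] by (simp add: Field_card_of)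
  qed
qed

end

section \<open>The functorial expansion\<close>

locale closure_expansion = aec_with_intersections \<tau> \<K>
  for \<tau> :: "('f, 'r) vocab" and \<K> :: "('u, 'f, 'r) ordered_class" +
  fixes E :: "nat \<Rightarrow> 'r"
  assumes inj_E: "inj E" and E_new: "range E \<inter> dom (rels \<tau>) = {}"
begin

definition voc_E :: "('f, 'r) vocab"
  where "voc_E = Vocab (funs \<tau>) (\<lambda>R. if R \<in> range E then Some (Suc (inv E R)) else rels \<tau> R)"

lemma funs_voc_E [simp]: "funs voc_E = funs \<tau>"
  and rels_voc_E_E [simp]: "rels voc_E (E n) = Some (Suc n)"
  and rels_voc_E: "R \<notin> range E \<Longrightarrow> rels voc_E R = rels \<tau> R"
  using inj_E by (auto simp: voc_E_def)

lemma rels_le_voc_E: "rels \<tau> \<subseteq>\<^sub>m rels voc_E"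
  using E_new by (auto simp: map_le_def voc_E_def)

lemma dom_rels_voc_E: "dom (rels voc_E) = dom (rels \<tau>) \<union> range E"
  by (auto simp: voc_E_def split: if_splits)

lemma subvocab_voc_E: "subvocab \<tau> voc_E"
  using rels_le_voc_E by (simp add: subvocab_def)

definition expand :: "('u, 'f, 'r) struct \<Rightarrow> ('u, 'f, 'r) struct" where
  "expand M = Struct voc_E (univ M) (fint M)
     (\<lambda>R. if R \<in> range E
       then {b # a | b a. length a = inv E R \<and> set a \<subseteq> univ M \<and> b \<in> hull M (set a)}
       else rint M R)"

lemma voc_expand [simp]: "voc (expand M) = voc_E"
  and univ_expand [simp]: "univ (expand M) = univ M"
  and fint_expand [simp]: "fint (expand M) = fint M"
  by (simp_all add: expand_def)

lemma rint_expand: "R \<notin> range E \<Longrightarrow> rint (expand M) R = rint M R"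
  by (simp add: expand_def)

lemma Cons_in_rint_expand:
  "b # a \<in> rint (expand M) (E n) \<longleftrightarrow> length a = n \<and> set a \<subseteq> univ M \<and> b \<in> hull M (set a)"
  using inj_E by (simp add: expand_def)

lemma rel_voc_E_cases:
  assumes "rels voc_E R = Some (length xs)"
  obtains (E) n b a where "R = E n" "xs = b # a" "length a = n"
    | (old) "R \<notin> range E" "rels \<tau> R = Some (length xs)"
proof (cases "R \<in> range E")
  case True
  then obtain n where "R = E n" by blast
  with assms show ?thesis using E by (cases xs) auto
qed (use assms old rels_voc_E in auto)

lemma is_structure_expand:
  assumes M: "M \<in> K"
  shows "is_structure (expand M)"
proof (rule is_structureI)
  have st: "is_structure M" "voc M = \<tau>" using M by simp_all
  show "set_sized (univ (expand M))" using st(1) by (simp add: is_structure_def)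
  show "fint (expand M) g xs \<in> univ (expand M)"
    if "funs (voc (expand M)) g = Some n" "length xs = n" "set xs \<subseteq> univ (expand M)" for g n xs
    using structure_fint_closed[OF st(1), of g n xs] st(2) that by simp
  show "fint (expand M) g xs = undefined"
    if "\<And>n. funs (voc (expand M)) g = Some n \<Longrightarrow> length xs = n \<Longrightarrow> \<not> set xs \<subseteq> univ (expand M)" for g xs
    using structure_fint_undefined[OF st(1), of g xs] st(2) that by simp
  show "rels (voc (expand M)) R = Some (length xs) \<and> set xs \<subseteq> univ (expand M)"
    if "xs \<in> rint (expand M) R" for R xs
  proof (cases "R \<in> range E")
    case True
    then obtain b a where "xs = b # a" "R = E (length a)" "set a \<subseteq> univ M" "b \<in> hull M (set a)"
      using \<open>xs \<in> rint (expand M) R\<close> inj_E by (auto simp: expand_def)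
    then show ?thesis using hull_subset[OF M, of "set a"] by auto
  next
    case False
    then show ?thesis
      using that structure_rintD[OF st(1), of xs R] st(2) by (simp add: rint_expand rels_voc_E)
  qed
qed

lemma reduct_expand:
  assumes "M \<in> K"
  shows "reduct \<tau> (expand M) = M"
proof -
  have "reduct \<tau> (expand M) = reduct \<tau> M"
    using E_new by (auto simp: reduct_def fun_eq_iff expand_def)
  then show ?thesis using reduct_self[of M] assms by simp
qed

lemma iso_expand:
  assumes "iso h M N" "M \<in> K"
  shows "iso h (expand M) (expand N)"
proof (rule isoI)
  note st = isoD[OF assms(1)]
  have N: "N \<in> K" using iso_mem_K assms by blast
  show "is_structure (expand M)" "is_structure (expand N)"
    using is_structure_expand assms(2) N by auto
  show "bij_betw h (univ (expand M)) (univ (expand N))" using st(4) by simp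
  show "h (fint (expand M) g xs) = fint (expand N) g (map h xs)"
    if "funs (voc (expand M)) g = Some (length xs)" "set xs \<subseteq> univ (expand M)" for g xs
    using iso_fint[OF assms(1), of g xs] that assms(2) by simp
  show "map h xs \<in> rint (expand N) R \<longleftrightarrow> xs \<in> rint (expand M) R"
    if "rels (voc (expand M)) R = Some (length xs)" and xs: "set xs \<subseteq> univ (expand M)" for R xs
    using that(1)[unfolded voc_expand]
  proof (cases rule: rel_voc_E_cases)
    case (E n b a)
    have a: "set a \<subseteq> univ M" "b \<in> univ M" using xs E(2) by auto
    have "h b \<in> h ` hull M (set a) \<longleftrightarrow> b \<in> hull M (set a)"
      using inj_on_image_mem_iff[OF st(5)] hull_subset[OF assms(2) a(1)] a(2) by blast
    moreover have "set (map h a) \<subseteq> univ N" using a(1) st(6) by auto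
    ultimately show ?thesis
      using iso_hull[OF assms a(1)] E a by (simp add: Cons_in_rint_expand)
  next
    case old
    then show ?thesis using iso_rint[OF assms(1), of R xs] xs assms(2) by (simp add: rint_expand)
  qed
qed simp

text \<open>Tuples from \<open>M\<close> have the same closure in \<open>M\<close> and in
  \<open>N\<close>, so the \<open>E n\<close> of \<open>M\<close> are restrictions of those of
  \<open>N\<close>. This is the substructure clause of functoriality.\<close>

lemma expand_restrict:
  assumes "M \<preceq> N"
  shows "expand M = restrict (expand N) (univ M)"
proof (rule struct.expand, intro conjI)
  note M = le_eq_restrict[OF assms]
  have "fint M = fint (restrict N (univ M))" using M by simp
  then show "fint (expand M) = fint (restrict (expand N) (univ M))"
    by (simp add: restrict_def cong: if_cong)
  show "rint (expand M) = rint (restrict (expand N) (univ M))"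
  proof (intro ext set_eqI)
    fix R xs
    have "rint M R = rint (restrict N (univ M)) R" using M by simp
    then have old: "rint M R = {xs \<in> rint N R. set xs \<subseteq> univ M}" by (simp add: restrict_def)
    show "xs \<in> rint (expand M) R \<longleftrightarrow> xs \<in> rint (restrict (expand N) (univ M)) R"
    proof (cases "R \<in> range E")
      case True
      have "b \<in> univ M" if "b \<in> hull M (set a)" "set a \<subseteq> univ M" for a b
        using hull_subset[OF le_in_K(1)[OF assms] that(2)] that(1) by blast
      then show ?thesis
        using True hull_absolute[OF assms] le_univ[OF assms]
        by (auto simp: expand_def restrict_def; blast)
    next
      case False
      then show ?thesis using old by (simp add: rint_expand restrict_def)
    qed
  qed
qed simp_all

lemma expand_reduct:
  assumes N: "is_structure N" "voc N = voc_E" "reduct \<tau> N \<in> K"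
    and hull: "\<And>a b. set a \<subseteq> univ N \<Longrightarrow> b \<in> univ N \<Longrightarrow>
      b # a \<in> rint N (E (length a)) \<longleftrightarrow> b \<in> hull (reduct \<tau> N) (set a)"
  shows "expand (reduct \<tau> N) = N"
proof (rule structure_eqI[OF is_structure_expand[OF N(3)] N(1)])
  show "fint (expand (reduct \<tau> N)) g xs = fint N g xs"
    if "funs (voc (expand (reduct \<tau> N))) g = Some (length xs)" for g xs
    using that by (auto simp: reduct_def)
  show "xs \<in> rint (expand (reduct \<tau> N)) R \<longleftrightarrow> xs \<in> rint N R"
    if "rels (voc (expand (reduct \<tau> N))) R = Some (length xs)" "set xs \<subseteq> univ (expand (reduct \<tau> N))" for R xs
    using that(1)[unfolded voc_expand]
  proof (cases rule: rel_voc_E_cases)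
    case (E n b a)
    then show ?thesis using hull[of a b] that(2) by (simp add: Cons_in_rint_expand)
  next
    case old
    then show ?thesis by (auto simp: rint_expand reduct_def)
  qed
qed (use N(2) in simp_all)

definition K_E :: "('u, 'f, 'r) ordered_class" where
  "K_E = (expand ` K, {(M, N). M \<in> expand ` K \<and> N \<in> expand ` K \<and> reduct \<tau> M \<preceq> reduct \<tau> N})"

lemma functorial_expansion_K_E: "functorial_expansion \<tau> \<K> voc_E K_E"
  unfolding functorial_expansion_def
proof (intro conjI ballI allI impI)
  show "subvocab \<tau> voc_E" by (rule subvocab_voc_E)
  show "bij_betw (reduct \<tau>) (fst K_E) (fst \<K>)"
    by (rule bij_betwI'[where f = "reduct \<tau>"]) (auto simp: K_E_def reduct_expand)
  show "iso h M N" if "M \<in> fst K_E" "N \<in> fst K_E" "iso h (reduct \<tau> M) (reduct \<tau> N)" for M N h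
    using that iso_expand by (auto simp: K_E_def reduct_expand)
  show "substructure M N" if MN: "M \<in> fst K_E" "N \<in> fst K_E" "reduct \<tau> M \<preceq> reduct \<tau> N" for M N
  proof -
    obtain P Q where "P \<in> K" "M = expand P" "Q \<in> K" "N = expand Q"
      using MN(1,2) by (auto simp: K_E_def)
    then show ?thesis
      using MN(3) expand_restrict[of P Q] is_structure_expand[of P] is_structure_expand[of Q] le_univ[of P Q]
      by (simp add: reduct_expand substructure_iff)
  qed
qed (auto simp: K_E_def is_structure_expand)

section \<open>Recognising expanded members of the class and their ordering\<close>

definition E_set :: "('u, 'f, 'r) struct \<Rightarrow> 'u list \<Rightarrow> 'u set"
  where "E_set N a = {b \<in> univ N. b # a \<in> rint N (E (length a))}"

lemma E_set_expand: "M \<in> K \<Longrightarrow> set a \<subseteq> univ M \<Longrightarrow> E_set (expand M) a = hull M (set a)"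
  using hull_subset[of M "set a"] by (auto simp: E_set_def Cons_in_rint_expand)

text \<open>This is what the axioms will say about the substructure on \<open>E_set N a\<close>. It
  isolates the part of the argument that is free of formulas.\<close>

definition generated_by :: "'u list \<Rightarrow> ('u, 'f, 'r) struct \<Rightarrow> bool" where
  "generated_by a N \<longleftrightarrow> set a \<subseteq> univ N \<and> (\<exists>M \<in> K. N = expand M \<and> hull M (set a) = univ M)"

text \<open>The reduct of \<open>M\<close> is in the class by isomorphism invariance, and
  \<open>M\<close> is its expansion because \<open>h\<close> maps both isomorphically to
  \<open>N\<close>. That \<open>a\<close> generates follows from compatibility of closures with
  isomorphisms.\<close>

lemma generated_by_iso:
  assumes "generated_by b N" "iso h M N" "map h a = b" "set a \<subseteq> univ M"
  shows "generated_by a M"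
proof -
  obtain Q where Q: "Q \<in> K" "N = expand Q" "hull Q (set b) = univ Q" and b: "set b \<subseteq> univ N"
    using assms(1) by (auto simp: generated_by_def)
  have voc: "voc M = voc_E" using isoD(3)[OF assms(2)] Q(2) by simp
  have i: "iso h (reduct \<tau> M) Q"
    using iso_reduct[OF assms(2), of \<tau>] subvocab_voc_E voc Q(1,2) reduct_expand by simp
  then have P: "reduct \<tau> M \<in> K"
    using iso_mem_K[OF Q(1) iso_sym[OF i]] by blast
  have "M = expand (reduct \<tau> M)"
    by (rule iso_unique_domain[OF assms(2)]) (use iso_expand[OF i P] Q(2) in simp_all)
  moreover have "hull (reduct \<tau> M) (set a) = univ (reduct \<tau> M)"
  proof -
    have "h ` hull (reduct \<tau> M) (set a) = h ` univ (reduct \<tau> M)"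
      using iso_hull[OF i P, of "set a"] assms(3,4) Q(3) isoD(6)[OF i] by auto
    then show ?thesis
      using inj_on_image_eq_iff[OF isoD(5)[OF i]] hull_subset[OF P, of "set a"] assms(4) by auto
  qed
  ultimately show ?thesis using P assms(4) by (auto simp: generated_by_def)
qed

lemma generated_by_hull:
  assumes "M \<in> K" "set a \<subseteq> univ M"
  shows "generated_by a (expand (restrict M (hull M (set a))))"
  using hull_le[OF assms] le_in_K(1)[OF hull_le[OF assms]] hull_absolute[OF hull_le[OF assms], of "set a"]
    hull_extensive[of "set a" M]
  by (auto simp: generated_by_def)

lemma mem_expandI:
  assumes N: "is_structure N" "voc N = voc_E"
    and gen: "\<And>a. set a \<subseteq> univ N \<Longrightarrow> generated_by a (restrict N (E_set N a))"
  shows "N \<in> expand ` K"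
proof -
  let ?P = "reduct \<tau> N"
  let ?X = "E_set N"
  let ?M = "\<lambda>a. restrict ?P (?X a)"
  have XN: "?X a \<subseteq> univ N" for a by (auto simp: E_set_def)
  have M: "?M a \<in> K" "restrict N (?X a) = expand (?M a)" "hull (?M a) (set a) = ?X a" "set a \<subseteq> ?X a"
    if a: "set a \<subseteq> univ N" for a
  proof -
    obtain M where M: "M \<in> K" "restrict N (?X a) = expand M" "hull M (set a) = univ M" "set a \<subseteq> ?X a"
      using gen[OF a] by (auto simp: generated_by_def)
    have "?M a = reduct \<tau> (restrict N (?X a))" by (simp add: reduct_restrict)
    also have "\<dots> = M" using M(1,2) by (simp add: reduct_expand)
    finally have eq: "?M a = M" .
    moreover from this have "univ M = ?X a" by (metis univ_restrict)
    ultimately show "?M a \<in> K" "restrict N (?X a) = expand (?M a)" "hull (?M a) (set a) = ?X a" "set a \<subseteq> ?X a"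
      using M by simp_all
  qed
  \<comment> \<open>The restriction of \<open>N\<close> to \<open>?X a\<close> is an expansion, so
    its relation \<open>E\<close> on \<open>b\<close> is the true closure of \<open>b\<close> there;
    this relation is also inherited from \<open>N\<close>.\<close>
  have inter: "?X b \<inter> ?X a = hull (?M a) (set b)" if "set a \<subseteq> univ N" "set b \<subseteq> ?X a" for a b
  proof -
    have "hull (?M a) (set b) = E_set (restrict N (?X a)) b"
      using E_set_expand[OF M(1)[OF that(1)], of b] M(2)[OF that(1)] that(2) by simp
    then show ?thesis using that(2) XN[of a] by (auto simp: E_set_def restrict_def)
  qed
  have X_mono: "?X b \<subseteq> ?X a" if a: "set a \<subseteq> univ N" and b: "set b \<subseteq> ?X a" for a b
  proof
    fix c assume c: "c \<in> ?X b"
    let ?d = "c # a @ b"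
    have d: "set ?d \<subseteq> univ N" using a b c XN[of a] XN[of b] by auto
    then have "set ?d \<subseteq> ?X ?d" by (rule M(4))
    then have *: "c \<in> ?X ?d" "set a \<subseteq> ?X ?d" "set b \<subseteq> ?X ?d" by auto
    \<comment> \<open>Inside \<open>?M ?d\<close> both sets are traces of a genuine closure
      operator, and its idempotence gives the claim.\<close>
    have "c \<in> hull (?M ?d) (set b)" using inter[OF d *(3)] c *(1) by blast
    moreover have "set b \<subseteq> hull (?M ?d) (set a)" using inter[OF d *(2)] b *(3) by blast
    ultimately have "c \<in> hull (?M ?d) (set a)"
      using hull_idem[OF M(1)[OF d], of "set a" "set b"] *(2) by auto
    then show "c \<in> ?X a" using inter[OF d *(2)] by blast
  qed
  have M_le: "?M b \<preceq> ?M a" if a: "set a \<subseteq> univ N" and b: "set b \<subseteq> ?X a" for a b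
  proof -
    have "hull (?M a) (set b) = ?X b" using inter[OF that] X_mono[OF that] by blast
    then show ?thesis
      using hull_le[OF M(1)[OF a], of "set b"] b restrict_restrict[OF X_mono[OF that], of ?P] by simp
  qed
  \<comment> \<open>The enumeration is an arbitrary choice. \<open>C_set\<close> shows that only the
    set of entries matters: tuples with the same entries satisfy both inclusions of
    \<open>X_mono\<close>.\<close>
  define C where "C F = ?X (SOME a. set a = F)" for F
  have C: "\<exists>a. set a = F \<and> C F = ?X a" if "finite F" for F
    using someI_ex[OF finite_list[OF that]] by (auto simp: C_def)
  have C_set: "C (set a) = ?X a" if a: "set a \<subseteq> univ N" for a
  proof -
    obtain b where "set b = set a" "C (set a) = ?X b" using C by blast
    then show ?thesis using X_mono[of a b] X_mono[of b a] M(4)[of a] M(4)[of b] a by auto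
  qed
  have P: "is_structure ?P" using is_structure_reduct[OF N(1)] subvocab_voc_E N(2) by simp
  have C_le: "restrict ?P (C F) \<preceq> restrict ?P (C G)"
    if FG: "finite G" "F \<subseteq> G" "G \<subseteq> univ ?P" for F G
  proof -
    obtain a b where "set a = G" "set b = F"
      using finite_list[OF FG(1)] finite_list[OF finite_subset[OF FG(2,1)]] by blast
    then show ?thesis using M_le[of a b] M(4)[of a] FG C_set[of a] C_set[of b] by auto
  qed
  have C_sub: "C F \<subseteq> univ ?P" if "finite F" for F using C[OF that] XN by auto
  have fc: "finitary_closure C (set a) = ?X a" if "set a \<subseteq> univ N" for a
  proof
    have "C F \<subseteq> ?X a" if "F \<subseteq> set a" for F
      using le_restrict_subset[OF C_le[of "set a" F]] C_set[OF \<open>set a \<subseteq> univ N\<close>] that \<open>set a \<subseteq> univ N\<close>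
      by simp
    then show "finitary_closure C (set a) \<subseteq> ?X a" by (intro finitary_closure_least)
    show "?X a \<subseteq> finitary_closure C (set a)"
      using C_set[OF that] by (auto simp: finitary_closure_def)
  qed
  have "finitary_closure C (univ N) = univ N"
  proof
    show "finitary_closure C (univ N) \<subseteq> univ N" using C_sub by (intro finitary_closure_least) simp
    show "univ N \<subseteq> finitary_closure C (univ N)"
    proof
      fix x assume x: "x \<in> univ N"
      then have "x \<in> finitary_closure C (set [x])" using fc[of "[x]"] M(4)[of "[x]"] by auto
      then show "x \<in> finitary_closure C (univ N)"
        using finitary_closure_mono[of "set [x]" "univ N" C] x by auto
    qed
  qed
  \<comment> \<open>Stated for every \<open>A\<close>: any instance puts the whole reduct into the
    class, and \<open>A = set a\<close> places \<open>?M a\<close> below it, so the closure of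
    \<open>a\<close> can be computed in \<open>?M a\<close>.\<close>
  moreover have "restrict ?P (finitary_closure C A) \<preceq> restrict ?P (finitary_closure C (univ N))"
    if "A \<subseteq> univ N" for A
    using that by (intro directed_union_le P C_le C_sub) simp_all
  ultimately have le_P: "restrict ?P (finitary_closure C A) \<preceq> ?P" if "A \<subseteq> univ N" for A
    using restrict_univ[OF P] that by simp
  then have PK: "?P \<in> K" using le_in_K(2) by blast
  have "hull ?P (set a) = ?X a" if "set a \<subseteq> univ N" for a
    using hull_absolute[OF le_P[OF that], of "set a"] fc[OF that] M(3,4)[OF that] by simp
  then have "expand ?P = N"
    by (intro expand_reduct N PK) (auto simp: E_set_def)
  then show ?thesis using PK by (metis image_eqI)
qed

text \<open>By the agreement of the \<open>E\<close>-sets, the smaller universe contains the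
  closures, taken in the larger structure, of all its finite subsets. Both reducts are thus directed
  unions of such closures, and \<open>directed_union_le\<close> compares them.\<close>

lemma reduct_leI:
  assumes "M \<in> expand ` K" "N \<in> expand ` K" "substructure M N"
    and E: "\<And>a. set a \<subseteq> univ M \<Longrightarrow> E_set M a = E_set N a"
  shows "reduct \<tau> M \<preceq> reduct \<tau> N"
proof -
  obtain P Q where P: "P \<in> K" "M = expand P" and Q: "Q \<in> K" "N = expand Q" using assms(1,2) by blast
  have PQ: "univ P \<subseteq> univ Q" and M: "M = restrict N (univ P)"
    using assms(3) P(2) Q(2) by (auto simp: substructure_iff)
  have P_eq: "P = restrict Q (univ P)"
    using arg_cong[OF M, of "reduct \<tau>"] P Q by (simp add: reduct_expand reduct_restrict)
  have hull: "hull Q F \<subseteq> univ P" if F: "finite F" "F \<subseteq> univ P" for F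
  proof -
    obtain a where "set a = F" using finite_list[OF F(1)] by blast
    then show ?thesis
      using E[of a] F P Q PQ hull_subset[OF P(1) F(2)] by (simp add: E_set_expand)
  qed
  have fc: "finitary_closure (hull Q) A = A"
    if "\<And>F. finite F \<Longrightarrow> F \<subseteq> A \<Longrightarrow> hull Q F \<subseteq> A" for A
  proof
    show "finitary_closure (hull Q) A \<subseteq> A" using that by (rule finitary_closure_least)
    show "A \<subseteq> finitary_closure (hull Q) A"
    proof
      fix x assume "x \<in> A"
      then have "hull Q {x} \<subseteq> finitary_closure (hull Q) A"
        unfolding finitary_closure_def by (intro Union_upper) auto
      then show "x \<in> finitary_closure (hull Q) A" using hull_extensive[of "{x}" Q] by blast
    qed
  qed
  have le: "restrict Q (hull Q F) \<preceq> restrict Q (hull Q G)" if "F \<subseteq> G" "G \<subseteq> univ Q" for F G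
    using hull_mono[OF Q(1) that(2,1)] that
    by (intro coherence[OF hull_le[OF Q(1)] hull_le[OF Q(1)]]) simp_all
  have "restrict Q (finitary_closure (hull Q) (univ P)) \<preceq> restrict Q (finitary_closure (hull Q) (univ Q))"
    by (rule directed_union_le) (simp_all add: Q(1) le PQ hull_subset[OF Q(1)])
  then have "P \<preceq> Q"
    using fc[of "univ P"] fc[of "univ Q"] hull hull_subset[OF Q(1)] P_eq restrict_univ[of Q] Q(1) by simp
  then show ?thesis using P Q by (simp add: reduct_expand)
qed

end

section \<open>Cardinalities\<close>

text \<open>A well-order below \<open>r\<close> is isomorphic to a proper initial segment of
  \<open>r\<close>. This puts small sets in bijection with ordinals below \<open>r\<close>.\<close>

lemma ex_underS_bij_betw:
  assumes "Card_order r" "|X| <o r"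
  shows "\<exists>\<alpha>\<in>Field r. \<exists>g. bij_betw g X (underS r \<alpha>)"
proof -
  have "Well_order r" using assms(1) by (auto simp: card_order_on_def)
  then obtain \<alpha> where \<alpha>: "\<alpha> \<in> Field r" "|X| =o Restr r (underS r \<alpha>)"
    using ordLess_iff_ordIso_Restr[of r "|X|"] assms(2) card_of_Well_order by blast
  have "Field (Restr r (underS r \<alpha>)) = underS r \<alpha>"
    using \<open>Well_order r\<close> underS_Field[of _ r \<alpha>]
    by (intro Refl_Field_Restr2) (auto simp: order_on_defs)
  then have "\<exists>g. bij_betw g X (underS r \<alpha>)"
    using \<alpha>(2) unfolding ordIso_def BNF_Wellorder_Embedding.iso_def by (auto simp: Field_card_of)
  then show ?thesis using \<alpha>(1) by blast
qed

text \<open>\<open>set_sized\<close> refers to the element type, here the type that carries the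
  cardinal. A proper initial segment of a cardinal is smaller than its field, hence than the
  type.\<close>

lemma set_sized_underS: "Card_order (r :: 'a rel) \<Longrightarrow> \<alpha> \<in> Field r \<Longrightarrow> set_sized (underS r \<alpha>)"
  unfolding set_sized_def
  using card_of_underS[of r \<alpha>] card_of_Field_ordIso[of r] card_of_mono1[of "Field r" UNIV]
  by (meson ordIso_symmetric ordLess_ordIso_trans ordLess_ordLeq_trans subset_UNIV)

text \<open>Disjunctions are indexed by the type that carries the bounding cardinal. A set below
  this cardinal injects into the type, and the image serves as the set of indices.\<close>

lemma ex_family_with_range:
  assumes "Card_order (r :: 'l rel)" "|S| <o r"
  shows "\<exists>F :: 'l \<Rightarrow> 'b option. ran F = S \<and> |dom F| <o r"
proof -
  have "|S| \<le>o |UNIV :: 'l set|"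
    using assms card_of_Field_ordIso[of r] card_of_mono1[of "Field r" UNIV]
    by (meson ordIso_symmetric ordLess_imp_ordLeq ordLess_ordIso_trans ordLess_ordLeq_trans subset_UNIV)
  then obtain j :: "'b \<Rightarrow> 'l" where j: "inj_on j S"
    unfolding card_of_ordLeq[symmetric] by blast
  let ?F = "\<lambda>l. if l \<in> j ` S then Some (inv_into S j l) else None"
  have "ran ?F = inv_into S j ` j ` S" by (auto simp: ran_def)
  then have "ran ?F = S" using j by simp
  moreover have "dom ?F = j ` S" by (auto simp: dom_def)
  then have "|dom ?F| <o r" using assms(2) card_of_image[of j S] ordLeq_ordLess_trans by metis
  ultimately show ?thesis by blast
qed

lemma finite_ordLess_Cinfinite:
  assumes "finite X" "Cinfinite r"
  shows "|X| <o r"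
proof (rule Cfinite_ordLess_Cinfinite[unfolded cfinite_def, OF conjI assms(2)])
  show "finite (Field |X| )" unfolding Field_card_of by (rule assms(1))
qed (rule card_of_Card_order)

context aec_with_intersections
begin

lemma LST_axiom_LS: "LST_axiom \<tau> \<K> (LS \<tau> \<K>)"
proof -
  have "\<exists>l\<in>{l. LST_axiom \<tau> \<K> l}. \<forall>l'\<in>{l. LST_axiom \<tau> \<K> l}. l \<le>o l'"
  proof (rule exists_minim_Well_order)
    show "{l. LST_axiom \<tau> \<K> l} \<noteq> {}" using aec_axioms(8) by simp
    show "\<forall>l\<in>{l. LST_axiom \<tau> \<K> l}. Well_order l" by (simp add: LST_axiom_def card_order_on_def)
  qed
  then have "\<exists>l. LST_axiom \<tau> \<K> l \<and> (\<forall>l'. LST_axiom \<tau> \<K> l' \<longrightarrow> l \<le>o l')" by blast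
  from someI_ex[OF this] show ?thesis by (simp add: LS_def)
qed

lemma Cinfinite_LS: "Cinfinite (LS \<tau> \<K>)"
proof -
  have "natLeq \<le>o LS \<tau> \<K>"
    using LST_axiom_LS ordLeq_transitive[OF ordLeq_csum2[OF natLeq_Card_order]]
    by (auto simp: LST_axiom_def)
  then show ?thesis
    using cinfinite_mono natLeq_cinfinite LST_axiom_LS by (auto simp: LST_axiom_def)
qed

text \<open>\<open>cardSuc\<close> of a cardinal on a type is a relation on the sets over that type.
  This dictates the index types of the formulas.\<close>

abbreviation \<kappa> :: "'u set rel"
  where "\<kappa> \<equiv> cardSuc (LS \<tau> \<K>)"

abbreviation \<mu> :: "('u + ('u list \<times> ('u, 'f, 'r) struct) set) set rel"
  where "\<mu> \<equiv> cardSuc (LS \<tau> \<K> +c |D_set \<K>| )"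

lemma Card_order_\<kappa>: "Card_order \<kappa>"
  using Cinfinite_LS Cinfinite_cardSuc by blast

lemma finite_ordLess_\<kappa>: "finite X \<Longrightarrow> |X| <o \<kappa>"
  using Cinfinite_cardSuc[OF Cinfinite_LS] by (rule finite_ordLess_Cinfinite[rotated])

text \<open>The Loewenheim-Skolem-Tarski axiom gives a member below \<open>N\<close> that contains
  \<open>A\<close> and has size at most that of \<open>LS\<close>, as the finite summand is
  absorbed. The closure is contained in it.\<close>

lemma hull_ordLess_\<kappa>:
  assumes "N \<in> K" "A \<subseteq> univ N" "finite A"
  shows "|hull N A| <o \<kappa>"
proof -
  obtain M where M: "A \<subseteq> univ M" "M \<preceq> N" "|univ M| \<le>o |A| +c LS \<tau> \<K>"
    using LST_axiom_LS assms(1,2) unfolding LST_axiom_def by blast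
  have "|A| \<le>o LS \<tau> \<K>"
    by (intro ordLess_imp_ordLeq finite_ordLess_Cinfinite assms(3) Cinfinite_LS)
  then have "|A| +c LS \<tau> \<K> =o LS \<tau> \<K>" by (rule csum_absorb2[OF Cinfinite_LS])
  then have "|hull N A| \<le>o LS \<tau> \<K>"
    using card_of_mono1[OF hull_least[OF M(2,1)]] M(3) ordLeq_transitive ordLeq_ordIso_trans by blast
  then show ?thesis
    using cardSuc_ordLeq_ordLess[of "LS \<tau> \<K>" "|hull N A|"] Cinfinite_LS by (simp add: card_of_Card_order)
qed

text \<open>The image will consist of the formulas coming from \<open>D_set\<close>, and
  \<open>y\<close> will be the formula of \<open>dummy_pair\<close>; the infinite summand
  \<open>LS\<close> absorbs it.\<close>

lemma insert_image_D_set_ordLess_\<mu>: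
  assumes "X \<subseteq> D_set \<K>"
  shows "|insert y (f ` X)| <o \<mu>"
proof -
  let ?r = "LS \<tau> \<K> +c |D_set \<K>|"
  have r: "Cinfinite ?r" by (rule Cinfinite_csum1[OF Cinfinite_LS])
  have "|f ` X| \<le>o |D_set \<K>|"
    using card_of_image card_of_mono1[OF assms] ordLeq_transitive by blast
  then have "|f ` X| \<le>o ?r"
    using ordLeq_csum2[OF card_of_Card_order] ordLeq_transitive by blast
  moreover have "|{y}| \<le>o ?r"
    by (intro ordLess_imp_ordLeq finite_ordLess_Cinfinite r) simp
  ultimately have "|{y} \<union> f ` X| \<le>o ?r"
    using r by (intro card_of_Un_ordLeq_infinite_Field) (simp_all add: cinfinite_def)
  then show ?thesis
    using cardSuc_ordLeq_ordLess[of ?r "|{y} \<union> f ` X|"] r by (simp add: card_of_Card_order)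
qed

end

section \<open>Quantifier-free formulas and substructures\<close>

text \<open>For structures on subsets of \<open>univ M\<close>, the reducts of \<open>M\<close> and
  \<open>N\<close> have the same restriction. This transfers the witness in the satisfaction clause
  of the structural quantifier.\<close>

lemma substructure_reduct_absolute:
  assumes "substructure M N" "subvocab \<sigma> (voc M)" "univ N0 \<subseteq> univ M"
  shows "substructure N0 (reduct \<sigma> M) \<longleftrightarrow> substructure N0 (reduct \<sigma> N)"
proof -
  have M: "is_structure M" "is_structure N" "voc M = voc N" "univ M \<subseteq> univ N" "M = restrict N (univ M)"
    using assms(1) substructure_iff[of M N] by (auto simp: substructure_def)
  have "restrict (reduct \<sigma> M) (univ N0) = restrict (reduct \<sigma> N) (univ N0)"
    using M(5) assms(3) restrict_restrict[OF assms(3), of N] by (metis reduct_restrict)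
  then show ?thesis
    using is_structure_reduct[OF M(1) assms(2)] is_structure_reduct[OF M(2), of \<sigma>] M(3,4) assms(2,3)
    by (auto simp: substructure_iff)
qed

lemma tm_val_substructure:
  assumes "substructure M N"
  shows "t \<in> terms (voc M) \<Longrightarrow> e ` tm_vars t \<subseteq> univ M \<Longrightarrow> tm_val M e t = tm_val N e t \<and> tm_val M e t \<in> univ M"
proof (induction t rule: terms.induct)
  case (2 g ts)
  have "map (tm_val M e) ts = map (tm_val N e) ts" "set (map (tm_val M e) ts) \<subseteq> univ M"
    using 2 by (auto simp: image_UN)
  moreover from this have "fint M g (map (tm_val M e) ts) = fint N g (map (tm_val M e) ts)"
    using assms 2(1) by (auto simp: substructure_def)
  moreover have "is_structure M" using assms by (simp add: substructure_def)
  ultimately have "fint M g (map (tm_val M e) ts) \<in> univ M"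
      "fint M g (map (tm_val M e) ts) = fint N g (map (tm_val N e) ts)"
    using structure_fint_closed[of M g "length ts" "map (tm_val M e) ts"] 2(1) by (simp, metis)
  then show ?case by simp
qed simp

lemma sat_atomic_substructure:
  assumes "substructure M N" "\<phi> \<in> atomic_fms (voc M)" "e ` fv \<phi> \<subseteq> univ M"
  shows "sat M \<phi> e \<longleftrightarrow> sat N \<phi> e"
  using assms(2)
proof (cases rule: atomic_fms.cases)
  case (1 s t)
  then have "e ` tm_vars s \<subseteq> univ M" "e ` tm_vars t \<subseteq> univ M" using assms(3) by auto
  then show ?thesis
    using tm_val_substructure[OF assms(1) 1(2)] tm_val_substructure[OF assms(1) 1(3)] 1(1) by simp
next
  case (2 R ts)
  have *: "tm_val M e t = tm_val N e t \<and> tm_val M e t \<in> univ M" if "t \<in> set ts" for t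
    using tm_val_substructure[OF assms(1), of t e] 2 that assms(3) by auto
  then have "map (tm_val M e) ts = map (tm_val N e) ts" by simp
  moreover have "set (map (tm_val M e) ts) \<subseteq> univ M" unfolding set_map using * by blast
  moreover from this have "map (tm_val M e) ts \<in> rint M R \<longleftrightarrow> map (tm_val M e) ts \<in> rint N R"
    using assms(1) 2 by (auto simp: substructure_def)
  ultimately have "map (tm_val M e) ts \<in> rint M R \<longleftrightarrow> map (tm_val N e) ts \<in> rint N R" by metis
  then show ?thesis using 2(1) by simp
qed

text \<open>Assignments may take values outside \<open>univ N\<close>. The set \<open>V\<close>
  records the variables known to have values inside, and each quantifier adds its own.\<close>

lemma sat_foldr_AllI:
  assumes "\<And>e'. e' ` (V \<union> set vs) \<subseteq> univ N \<Longrightarrow> sat N \<phi> e'" "e ` V \<subseteq> univ N"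
  shows "sat N (foldr All vs \<phi>) e"
  using assms
proof (induction vs arbitrary: V e)
  case (Cons v vs)
  have "sat N (foldr All vs \<phi>) (e(v := b))" if "b \<in> univ N" for b
    using Cons.prems that by (intro Cons.IH[of "insert v V"]) auto
  then show ?case by simp
qed simp

lemma sat_foldr_AllD: "sat N (foldr All vs \<phi>) e \<Longrightarrow> e ` set vs \<subseteq> univ N \<Longrightarrow> sat N \<phi> e"
proof (induction vs)
  case (Cons v vs)
  then have "sat N (foldr All vs \<phi>) (e(v := e v))" by auto
  then show ?case using Cons by simp
qed simp

lemma fv_foldr_All: "fv (foldr All vs \<phi>) = fv \<phi> - set vs"
  by (induction vs) auto

lemma foldr_All_in_struct_logic:
  "\<phi> \<in> struct_logic \<kappa> \<mu> \<tau> \<Longrightarrow> foldr All vs \<phi> \<in> struct_logic \<kappa> \<mu> \<tau>"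
  by (induction vs) (auto intro: struct_logic.all)

lemma foldr_All_subfm:
  assumes "\<And>\<phi>. \<phi> \<in> F \<Longrightarrow> immediate_subfms \<phi> \<subseteq> F" "foldr All vs \<phi> \<in> F"
  shows "\<phi> \<in> F"
  using assms(2)
proof (induction vs)
  case (Cons v vs)
  then show ?case using assms(1)[of "All v (foldr All vs \<phi>)"] by simp
qed simp

section \<open>The axioms\<close>

type_synonym ('u, 'f, 'r) closure_fm =
  "('f, 'r, 'u set, ('u + ('u list \<times> ('u, 'f, 'r) struct) set) set) fm"

context closure_expansion
begin

text \<open>Variables below \<open>n\<close> hold the parameters and variable \<open>n\<close> the
  element, which is the head of a tuple in the relation \<open>E n\<close>.\<close>

definition E_fm :: "nat \<Rightarrow> ('u, 'f, 'r) closure_fm"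
  where "E_fm n = Rel (E n) (map Var (n # [0..<n]))"

text \<open>The equations name the parameters one by one. The head defines the whole set once more:
  it makes the formula of \<open>dummy_pair\<close> contradictory also for \<open>n = 0\<close>,
  where there are no singletons.\<close>

definition parameter_fms :: "nat \<Rightarrow> ('u, 'f, 'r) closure_fm list"
  where "parameter_fms n = E_fm n # map (\<lambda>i. Eq (Var n) (Var i)) [0..<n]"

definition Q_fm ::
  "nat \<Rightarrow> ('u set, 'f, 'r) struct \<times> 'u set set list \<Rightarrow> ('u, 'f, 'r) closure_fm" where
  "Q_fm n = (\<lambda>(R, A). QStruct R A n (E_fm n) (replicate (Suc n) n) (parameter_fms n))"

lemma length_parameter_fms [simp]: "length (parameter_fms n) = Suc n"
  by (simp add: parameter_fms_def)

lemma E_fm_atomic: "E_fm n \<in> atomic_fms voc_E"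
  by (auto simp: E_fm_def intro!: atomic_fms.intros terms.intros)

lemma parameter_fms_atomic: "set (parameter_fms n) \<subseteq> atomic_fms voc_E"
  using E_fm_atomic by (auto simp: parameter_fms_def intro!: atomic_fms.intros terms.intros)

lemma fv_E_fm: "fv (E_fm n) = {..n}"
  by (auto simp: E_fm_def)

lemma fv_Q_fm: "fv (Q_fm n p) = {..<n}"
proof -
  let ?ps = "parameter_fms n"
  have "V - {y} \<subseteq> {..<n}" if "(y, V) \<in> set (zip (replicate (Suc n) n) (map fv ?ps))" for y V
  proof -
    have "y = n" "V \<in> fv ` set ?ps"
      using set_zip_leftD[OF that] set_zip_rightD[OF that] by auto
    then show ?thesis by (auto simp: parameter_fms_def fv_E_fm)
  qed
  then show ?thesis by (auto simp: Q_fm_def fv_E_fm split: prod.split)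
qed

lemma def_set_E_fm: "def_set N (E_fm n) n e = E_set N (map e [0..<n])"
proof -
  have "map (tm_val N (e(n := b))) (map Var (n # [0..<n])) = b # map e [0..<n]" for b
    by simp
  then show ?thesis by (simp add: def_set_def E_fm_def E_set_def del: list.map map_map)
qed

lemma def_set_parameter_fms:
  assumes "e ` {..<n} \<subseteq> univ N" "i < Suc n"
  shows "def_set N (parameter_fms n ! i) n e =
    (case i of 0 \<Rightarrow> E_set N (map e [0..<n]) | Suc j \<Rightarrow> {e j})"
  using assms by (auto simp: parameter_fms_def def_set_E_fm split: nat.split) (auto simp: def_set_def)

lemma sat_Q_fm:
  assumes e: "e ` {..<n} \<subseteq> univ N"
  defines "a \<equiv> map e [0..<n]"
  shows "sat N (Q_fm n (R, A)) e \<longleftrightarrow>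
    set a \<subseteq> E_set N a \<and>
    (\<exists>N0 h. substructure N0 (reduct (voc R) N) \<and> univ N0 = E_set N a \<and> iso h N0 R \<and>
       h ` E_set N a = A ! 0 \<and> (\<forall>i<n. {h (a ! i)} = A ! Suc i))"
proof -
  let ?ps = "parameter_fms n"
  have Q: "{b \<in> univ N. sat N (?ps ! i) (e(n := b))} = (case i of 0 \<Rightarrow> E_set N a | Suc j \<Rightarrow> {e j})"
    if "i < Suc n" for i
    using def_set_parameter_fms[OF e that] unfolding a_def def_set_def .
  have P: "{b \<in> univ N. sat N (E_fm n) (e(n := b))} = E_set N a"
    using def_set_E_fm unfolding a_def def_set_def .
  have "sat N (Q_fm n (R, A)) e \<longleftrightarrow>
    (\<forall>i<Suc n. (case i of 0 \<Rightarrow> E_set N a | Suc j \<Rightarrow> {e j}) \<subseteq> E_set N a) \<and>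
    (\<exists>N0 h. substructure N0 (reduct (voc R) N) \<and> univ N0 = E_set N a \<and> iso h N0 R \<and>
       (\<forall>i<Suc n. h ` (case i of 0 \<Rightarrow> E_set N a | Suc j \<Rightarrow> {e j}) = A ! i))"
    by (simp add: Q_fm_def P Q Let_def del: replicate_Suc)
  then show ?thesis by (simp add: All_less_Suc2 a_def image_subset_iff Ball_def)
qed

section \<open>Copies of closures on ordinals, and the pairs they give\<close>

definition is_copy :: "'u list \<Rightarrow> ('u, 'f, 'r) struct \<Rightarrow> ('u set, 'f, 'r) struct \<Rightarrow> ('u \<Rightarrow> 'u set) \<Rightarrow> bool" where
  "is_copy a M R g \<longleftrightarrow> iso g (expand (restrict M (hull M (set a)))) R \<and>
     (\<exists>\<alpha>\<in>Field \<kappa>. univ R = underS \<kappa> \<alpha>)"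

lemma ex_copy:
  assumes "M \<in> K" "set a \<subseteq> univ M"
  shows "\<exists>p. is_copy a M (fst p) (snd p)"
proof -
  let ?C = "expand (restrict M (hull M (set a)))"
  have C: "is_structure ?C" using is_structure_expand[OF le_in_K(1)[OF hull_le[OF assms]]] .
  obtain \<alpha> g where \<alpha>: "\<alpha> \<in> Field \<kappa>" "bij_betw g (univ ?C) (underS \<kappa> \<alpha>)"
    using ex_underS_bij_betw[OF Card_order_\<kappa> hull_ordLess_\<kappa>[OF assms finite_set]] by auto
  then show ?thesis
    using ex_iso_on[OF C \<alpha>(2) set_sized_underS[OF Card_order_\<kappa> \<alpha>(1)]] by (auto simp: is_copy_def)
qed

definition representative ::
  "('u list \<times> ('u, 'f, 'r) struct) set \<Rightarrow> 'u list \<times> ('u, 'f, 'r) struct"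
  where "representative d = (SOME q. q \<in> d)"

definition copy :: "'u list \<times> ('u, 'f, 'r) struct \<Rightarrow> ('u set, 'f, 'r) struct \<times> ('u \<Rightarrow> 'u set)"
  where "copy q = (SOME p. is_copy (fst q) (snd q) (fst p) (snd p))"

definition class_pair ::
  "('u list \<times> ('u, 'f, 'r) struct) set \<Rightarrow> ('u set, 'f, 'r) struct \<times> 'u set set list" where
  "class_pair d = (let q = representative d; (R, g) = copy q in (R, univ R # map (\<lambda>c. {g c}) (fst q)))"

text \<open>The following pair gives an unsatisfiable formula. It makes the disjunctions nonempty also if
  no member of the class contains an \<open>n\<close>-tuple.\<close>

definition dummy_structure :: "('u set, 'f, 'r) struct" where
  "dummy_structure = (SOME R. is_structure R \<and> voc R = Vocab Map.empty Map.empty \<and> univ R \<noteq> {} \<and>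
     (\<exists>\<alpha>\<in>Field \<kappa>. univ R = underS \<kappa> \<alpha>))"

definition dummy_pair :: "nat \<Rightarrow> ('u set, 'f, 'r) struct \<times> 'u set set list"
  where "dummy_pair n = (dummy_structure, replicate (Suc n) {})"

text \<open>Equivalent pointed structures have tuples of equal length, so the length of the
  representative selects exactly the classes of \<open>n\<close>-tuples.\<close>

definition pairs :: "nat \<Rightarrow> (('u set, 'f, 'r) struct \<times> 'u set set list) set" where
  "pairs n = insert (dummy_pair n) (class_pair ` {d \<in> D_set \<K>. length (fst (representative d)) = n})"

lemma dummy_structure:
  "is_structure dummy_structure \<and> voc dummy_structure = Vocab Map.empty Map.empty \<and>
   univ dummy_structure \<noteq> {} \<and> (\<exists>\<alpha>\<in>Field \<kappa>. univ dummy_structure = underS \<kappa> \<alpha>)"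
proof -
  \<comment> \<open>A one-element set is smaller than \<kappa>, which yields a nonempty ordinal
    below \<kappa>.\<close>
  obtain \<alpha> g where \<alpha>: "\<alpha> \<in> Field \<kappa>" "bij_betw g {undefined :: 'u} (underS \<kappa> \<alpha>)"
    using ex_underS_bij_betw[OF Card_order_\<kappa> finite_ordLess_\<kappa>] by blast
  let ?R = "Struct (Vocab Map.empty Map.empty) (underS \<kappa> \<alpha>) (\<lambda>_ _. undefined) (\<lambda>_. {})"
  have "is_structure ?R"
    using set_sized_underS[OF Card_order_\<kappa> \<alpha>(1)] by (simp add: is_structure_def)
  moreover have "underS \<kappa> \<alpha> \<noteq> {}" using \<alpha>(2) by (auto simp: bij_betw_def)
  ultimately have "\<exists>R :: ('u set, 'f, 'r) struct. is_structure R \<and> voc R = Vocab Map.empty Map.empty \<and> univ R \<noteq> {} \<and>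
     (\<exists>\<alpha>\<in>Field \<kappa>. univ R = underS \<kappa> \<alpha>)"
    using \<alpha>(1) by (intro exI[of _ ?R]) auto
  then show ?thesis unfolding dummy_structure_def by (rule someI_ex)
qed

lemma not_sat_dummy_pair:
  fixes N :: "('u, 'f, 'r) struct"
  assumes "e ` {..<n} \<subseteq> univ N"
  shows "\<not> sat N (Q_fm n (dummy_pair n)) e"
proof
  assume "sat N (Q_fm n (dummy_pair n)) e"
  then obtain N0 and h :: "'u \<Rightarrow> 'u set"
    where "univ N0 = E_set N (map e [0..<n])" "iso h N0 dummy_structure" "h ` E_set N (map e [0..<n]) = {}"
    unfolding dummy_pair_def sat_Q_fm[OF assms] by auto
  then show False using isoD(6)[of h N0 dummy_structure] dummy_structure by auto
qed

lemma D_set_representative: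
  assumes "d \<in> D_set \<K>"
  shows "representative d \<in> d"
proof -
  obtain a M where aM: "(a, M) \<in> pointed \<K>" "d = pointed_equiv \<K> `` {(a, M)}"
    using assms by (auto simp: D_set_def elim!: quotientE)
  then have "cl \<K> M (set a) \<in> K"
    using hull_le le_in_K(1) by (auto simp: pointed_def cl_eq)
  then have "((a, M), (a, M)) \<in> pointed_equiv \<K>"
    using aM(1) iso_refl[of "cl \<K> M (set a)"] by (auto simp: pointed_equiv_def intro!: exI[of _ "\<lambda>x. x"])
  then show ?thesis using aM(2) by (auto simp: representative_def intro: someI)
qed

lemma D_set_representative_in_K:
  assumes "d \<in> D_set \<K>" "representative d = (a, M)"
  shows "M \<in> K" "set a \<subseteq> univ M"
  using D_set_representative[OF assms(1)] assms
  by (auto simp: D_set_def pointed_equiv_def pointed_def elim!: quotientE)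

lemma class_pair_copy:
  assumes "d \<in> D_set \<K>" "representative d = (a, M)"
  obtains R g where "is_copy a M R g" "class_pair d = (R, univ R # map (\<lambda>c. {g c}) a)"
proof -
  obtain R g where Rg: "copy (a, M) = (R, g)" by fastforce
  have "is_copy a M R g"
    using someI_ex[OF ex_copy[OF D_set_representative_in_K[OF assms]]] Rg by (simp add: copy_def)
  moreover have "class_pair d = (R, univ R # map (\<lambda>c. {g c}) a)"
    using Rg assms(2) by (simp add: class_pair_def Let_def)
  ultimately show ?thesis using that by blast
qed

text \<open>The isomorphism \<open>h\<close> from the defined set and the copying map
  \<open>g\<close> of the representative have the same target. So \<open>h\<close> followed by the
  inverse of \<open>g\<close> is an isomorphism onto an expanded closure that sends \<open>a\<close>
  to \<open>b\<close>, and being generated is pulled back along it.\<close>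

lemma sat_class_pair_imp_generated:
  assumes N: "is_structure N" "voc N = voc_E" and e: "e ` {..<n} \<subseteq> univ N"
    and d: "d \<in> D_set \<K>" "length (fst (representative d)) = n"
    and sat: "sat N (Q_fm n (class_pair d)) e"
  defines "a \<equiv> map e [0..<n]"
  shows "generated_by a (restrict N (E_set N a))"
proof -
  obtain b M where bM: "representative d = (b, M)" by fastforce
  note M = D_set_representative_in_K[OF d(1) bM]
  obtain R g where R: "is_copy b M R g" "class_pair d = (R, univ R # map (\<lambda>c. {g c}) b)"
    using class_pair_copy[OF d(1) bM] .
  let ?C = "expand (restrict M (hull M (set b)))"
  have g: "iso g ?C R" using R(1) by (simp add: is_copy_def)
  \<comment> \<open>The prescribed structure has the full vocabulary, so the reduct in the
    satisfaction clause is \<open>N\<close> itself and the copy retains the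
    \<open>E n\<close>.\<close>
  then have voc: "voc R = voc N" using isoD(3) N(2) by force
  have n: "length b = n" using d(2) bM by simp
  obtain N0 and h :: "'u \<Rightarrow> 'u set" where sub: "set a \<subseteq> E_set N a" and N0: "substructure N0 N" "univ N0 = E_set N a"
    and h: "iso h N0 R" "\<And>i. i < n \<Longrightarrow> h (a ! i) = g (b ! i)"
    using sat unfolding R(2) sat_Q_fm[OF e] voc reduct_self[OF N(1)] a_def[symmetric]
    by (auto simp: n nth_Cons')
  have N0_eq: "restrict N (E_set N a) = N0" using N0 by (simp add: substructure_iff)
  let ?k = "\<lambda>x. inv_into (univ ?C) g (h x)"
  have "map ?k a = b"
  proof (rule nth_equalityI)
    fix i assume "i < length (map ?k a)"
    then have i: "i < n" by (simp add: a_def)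
    have "b ! i \<in> univ ?C" using i n hull_extensive[of "set b" M] by auto
    then show "map ?k a ! i = b ! i" using i h(2)[OF i] isoD(5)[OF g] by (simp add: a_def)
  qed (simp add: a_def n)
  then show ?thesis
    unfolding N0_eq
    using generated_by_iso[OF generated_by_hull[OF M] iso_trans[OF h(1) iso_sym[OF g]]] sub N0(2) by simp
qed

text \<open>The disjunct for the class of the tuple itself holds. Its representative may be another
  tuple in another structure, so the witness is the isomorphism given by the equivalence, followed
  by the copying map.\<close>

lemma ex_sat_class_pair:
  assumes M: "M \<in> K" and e: "e ` {..<n} \<subseteq> univ M"
  shows "\<exists>d\<in>D_set \<K>. length (fst (representative d)) = n \<and> sat (expand M) (Q_fm n (class_pair d)) e"
proof -
  let ?a = "map e [0..<n]"
  have a: "set ?a \<subseteq> univ M" using e by auto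
  let ?d = "pointed_equiv \<K> `` {(?a, M)}"
  have d: "?d \<in> D_set \<K>"
    unfolding D_set_def using M a by (intro quotientI) (simp add: pointed_def)
  obtain b P where bP: "representative ?d = (b, P)" by fastforce
  then have "((?a, M), (b, P)) \<in> pointed_equiv \<K>" using D_set_representative[OF d] by auto
  then obtain h where h: "iso h (restrict M (hull M (set ?a))) (restrict P (hull P (set b)))" "map h ?a = b"
    by (auto simp: pointed_equiv_def cl_eq)
  obtain R g where R: "is_copy b P R g" "class_pair ?d = (R, univ R # map (\<lambda>c. {g c}) b)"
    using class_pair_copy[OF d bP] .
  let ?N0 = "expand (restrict M (hull M (set ?a)))"
  note le = hull_le[OF M a]
  have g: "iso g (expand (restrict P (hull P (set b)))) R" using R(1) by (simp add: is_copy_def)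
  have gh: "iso (\<lambda>x. g (h x)) ?N0 R"
    by (rule iso_trans[OF iso_expand[OF h(1) le_in_K(1)[OF le]] g])
  have E: "E_set (expand M) ?a = hull M (set ?a)" by (rule E_set_expand[OF M a])
  have voc: "voc R = voc (expand M)" using isoD(3)[OF gh] by simp
  have "substructure ?N0 (expand M)"
    using expand_restrict[OF le] is_structure_expand[OF M] is_structure_expand[OF le_in_K(1)[OF le]] le_univ[OF le]
    by (simp add: substructure_iff)
  moreover have "{g (h (?a ! i))} = map (\<lambda>c. {g c}) b ! i" if "i < n" for i
    using that h(2)[symmetric] by simp
  ultimately have "sat (expand M) (Q_fm n (class_pair ?d)) e"
    unfolding R(2) using e
    by (subst sat_Q_fm) (use E voc hull_extensive[of "set ?a" M] gh isoD(6)[OF gh] reduct_self[OF is_structure_expand[OF M]] in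
        \<open>auto intro!: exI[of _ ?N0] exI[of _ "\<lambda>x. g (h x)"]\<close>)
  moreover have "length b = n" using h(2) by auto
  ultimately show ?thesis using d bP by (intro bexI[of _ ?d]) auto
qed

lemma pairs_wf:
  assumes "(R, A) \<in> pairs n"
  shows "is_structure R" "subvocab (voc R) voc_E" "\<exists>\<alpha>\<in>Field \<kappa>. univ R = underS \<kappa> \<alpha>"
    "length A = Suc n" "\<forall>X\<in>set A. X \<subseteq> univ R"
proof -
  have "is_structure R \<and> subvocab (voc R) voc_E \<and> (\<exists>\<alpha>\<in>Field \<kappa>. univ R = underS \<kappa> \<alpha>) \<and>
    length A = Suc n \<and> (\<forall>X\<in>set A. X \<subseteq> univ R)"
  proof (cases "(R, A) = dummy_pair n")
    case True
    then show ?thesis using dummy_structure by (auto simp: dummy_pair_def subvocab_def)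
  next
    case False
    then obtain d where d: "d \<in> D_set \<K>" "length (fst (representative d)) = n" "(R, A) = class_pair d"
      using assms by (auto simp: pairs_def)
    obtain a M where aM: "representative d = (a, M)" by fastforce
    obtain R' g where "is_copy a M R' g" "class_pair d = (R', univ R' # map (\<lambda>c. {g c}) a)"
      using class_pair_copy[OF d(1) aM] .
    then have g: "is_copy a M R g" "A = univ R # map (\<lambda>c. {g c}) a" using d(3) by simp_all
    have i: "iso g (expand (restrict M (hull M (set a)))) R" using g(1) by (simp add: is_copy_def)
    have "g c \<in> univ R" if "c \<in> set a" for c
      using isoD(6)[OF i] hull_extensive[of "set a" M] that by auto
    then show ?thesis
      using g isoD(2,3)[OF i] aM d(2) by (auto simp: is_copy_def subvocab_def)
  qed
  then show "is_structure R" "subvocab (voc R) voc_E" "\<exists>\<alpha>\<in>Field \<kappa>. univ R = underS \<kappa> \<alpha>"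
    "length A = Suc n" "\<forall>X\<in>set A. X \<subseteq> univ R" by blast+
qed

lemma Q_fm_in_struct_logic:
  assumes "p \<in> pairs n"
  shows "Q_fm n p \<in> struct_logic \<kappa> \<mu> voc_E"
proof -
  obtain R A where p: "p = (R, A)" by fastforce
  note wf = pairs_wf[OF assms[unfolded p]]
  then obtain \<alpha> where "\<alpha> \<in> Field \<kappa>" "univ R = underS \<kappa> \<alpha>" by blast
  moreover have "\<psi> \<in> struct_logic \<kappa> \<mu> voc_E" if "\<psi> \<in> insert (E_fm n) (set (parameter_fms n))" for \<psi>
    using that E_fm_atomic parameter_fms_atomic by (blast intro: struct_logic.atomic)
  ultimately show ?thesis
    unfolding p Q_fm_def prod.case using wf by (intro struct_logic.qstruct) auto
qed

section \<open>The theory and its models\<close>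

definition disjunction ::
  "nat \<Rightarrow> ('u, 'f, 'r) closure_fm"
  where "disjunction n = Disj (SOME F. ran F = Q_fm n ` pairs n \<and> |dom F| <o \<mu>)"

definition closure_axiom ::
  "nat \<Rightarrow> ('u, 'f, 'r) closure_fm"
  where "closure_axiom n = foldr All [0..<n] (disjunction n)"

lemma disjunction_family:
  obtains F where "disjunction n = Disj F" "ran F = Q_fm n ` pairs n" "|dom F| <o \<mu>"
proof -
  have "|Q_fm n ` pairs n| <o \<mu>"
    unfolding pairs_def image_insert image_image by (rule insert_image_D_set_ordLess_\<mu>) auto
  moreover have "Card_order \<mu>" by (rule cardSuc_Card_order[OF Card_order_csum])
  ultimately have "\<exists>F :: ('u + ('u list \<times> ('u, 'f, 'r) struct) set) set \<Rightarrow> ('u, 'f, 'r) closure_fm option.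
      ran F = Q_fm n ` pairs n \<and> |dom F| <o \<mu>"
    by (intro ex_family_with_range)
  from someI_ex[OF this] show ?thesis using that by (simp add: disjunction_def)
qed

lemma sat_disjunction: "sat N (disjunction n) e \<longleftrightarrow> (\<exists>p\<in>pairs n. sat N (Q_fm n p) e)"
proof -
  obtain F where F: "disjunction n = Disj F" "ran F = Q_fm n ` pairs n"
    using disjunction_family .
  have "ran (map_option (sat N) \<circ> F) = sat N ` ran F" by (force simp: ran_def)
  then show ?thesis by (simp add: F)
qed

lemma fv_disjunction: "fv (disjunction n) = {..<n}"
proof -
  obtain F where F: "disjunction n = Disj F" "ran F = Q_fm n ` pairs n"
    using disjunction_family .
  have "ran (map_option fv \<circ> F) = fv ` ran F" by (force simp: ran_def)
  also have "\<dots> = {{..<n}}" unfolding F(2) image_image fv_Q_fm by (auto simp: pairs_def)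
  finally show ?thesis by (simp add: F(1))
qed

lemma disjunction_in_struct_logic: "disjunction n \<in> struct_logic \<kappa> \<mu> voc_E"
proof -
  obtain F where F: "disjunction n = Disj F" "ran F = Q_fm n ` pairs n" "|dom F| <o \<mu>"
    using disjunction_family .
  show ?thesis
    using F(3) fv_disjunction[of n] Q_fm_in_struct_logic
    unfolding F(1) by (intro struct_logic.disj) (auto simp: F(2) simp del: fv.simps)
qed

lemma forall_Q_sentence_closure_axiom: "forall_Q_sentence (closure_axiom n)"
proof -
  obtain F where F: "disjunction n = Disj F" "ran F = Q_fm n ` pairs n"
    using disjunction_family .
  have "ran F = {QStruct R A n (E_fm n) (replicate (Suc n) n) (parameter_fms n) | R A. (R, A) \<in> pairs n}"
    (is "_ = ?S")
  proof
    show "ran F \<subseteq> ?S" unfolding F(2) by (auto simp: Q_fm_def)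
    show "?S \<subseteq> ran F"
    proof
      fix \<phi> assume "\<phi> \<in> ?S"
      then obtain R A where "\<phi> = Q_fm n (R, A)" "(R, A) \<in> pairs n" by (auto simp: Q_fm_def)
      then show "\<phi> \<in> ran F" unfolding F(2) by blast
    qed
  qed
  moreover have "closure_axiom n = foldr All [0..<n] (Disj F)" by (simp add: closure_axiom_def F(1))
  moreover have "pairs n \<noteq> {}" by (simp add: pairs_def)
  moreover have "qfree \<phi>" if "\<phi> \<in> atomic_fms voc_E" for \<phi> :: "('u, 'f, 'r) closure_fm"
    using that by (cases rule: atomic_fms.cases) (auto intro: qfree.intros)
  then have "qfree (E_fm n)" "\<forall>\<psi>\<in>set (parameter_fms n). qfree \<psi>"
    using E_fm_atomic parameter_fms_atomic by blast+
  moreover have "fv (closure_axiom n) = {}"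
    by (simp add: closure_axiom_def fv_foldr_All fv_disjunction atLeast0LessThan)
  ultimately show ?thesis
    unfolding forall_Q_sentence_def
    by (intro conjI exI[of _ "[0..<n]"] exI[of _ F] exI[of _ "pairs n"] exI[of _ n] exI[of _ "E_fm n"]
        exI[of _ "replicate (Suc n) n"] exI[of _ "parameter_fms n"])
qed

lemma sat_disjunction_expand:
  assumes "N \<in> expand ` K" "e ` {..<n} \<subseteq> univ N"
  shows "sat N (disjunction n) e"
proof -
  obtain M where M: "M \<in> K" "N = expand M" using assms(1) by blast
  then obtain d where "d \<in> D_set \<K>" "length (fst (representative d)) = n" "sat N (Q_fm n (class_pair d)) e"
    using ex_sat_class_pair[OF M(1), of e n] assms(2) by auto
  then show ?thesis unfolding sat_disjunction pairs_def by blast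
qed

lemma models_closure_axioms: "models voc_E (range closure_axiom) = expand ` K"
proof
  show "models voc_E (range closure_axiom) \<subseteq> expand ` K"
  proof
    fix N :: "('u, 'f, 'r) struct" assume N: "N \<in> models voc_E (range closure_axiom)"
    then have st: "is_structure N" "voc N = voc_E" by (auto simp: models_def)
    show "N \<in> expand ` K"
    proof (rule mem_expandI[OF st])
      fix a assume a: "set a \<subseteq> univ N"
      let ?n = "length a"
      \<comment> \<open>Only the values at the first \<open>?n\<close> variables matter; the default
        fills the rest.\<close>
      let ?e = "\<lambda>i. if i < ?n then a ! i else undefined"
      have e: "?e ` {..<?n} \<subseteq> univ N" using a by auto
      have map_e: "map ?e [0..<?n] = a" by (rule nth_equalityI) auto
      have "sat N (closure_axiom ?n) ?e" using N by (auto simp: models_def)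
      then have "sat N (disjunction ?n) ?e"
        using sat_foldr_AllD[of N "[0..<?n]" "disjunction ?n" ?e] e
        by (simp only: closure_axiom_def set_upt atLeast0LessThan)
      then obtain p where p: "p \<in> pairs ?n" "sat N (Q_fm ?n p) ?e"
        unfolding sat_disjunction by blast
      moreover have "p \<noteq> dummy_pair ?n" using not_sat_dummy_pair[OF e] p(2) by metis
      ultimately obtain d where "d \<in> D_set \<K>" "length (fst (representative d)) = ?n" "p = class_pair d"
        unfolding pairs_def by blast
      then show "generated_by a (restrict N (E_set N a))"
        using sat_class_pair_imp_generated[OF st e, of d] p(2) unfolding map_e by blast
    qed
  qed
  show "expand ` K \<subseteq> models voc_E (range closure_axiom)"
  proof
    fix N assume N: "N \<in> expand ` K"
    have "sat N (closure_axiom n) e" for n e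
      unfolding closure_axiom_def
    proof (rule sat_foldr_AllI[of "{}"])
      show "sat N (disjunction n) e'" if "e' ` ({} \<union> set [0..<n]) \<subseteq> univ N" for e'
        using that by (intro sat_disjunction_expand[OF N]) (simp add: atLeast0LessThan)
    qed simp
    then show "N \<in> models voc_E (range closure_axiom)"
      using N is_structure_expand by (auto simp: models_def)
  qed
qed

section \<open>The smallest fragment\<close>

abbreviation F_min :: "('u, 'f, 'r) closure_fm set"
  where "F_min \<equiv> smallest_fragment \<kappa> \<mu> voc_E (range closure_axiom)"

text \<open>An explicit fragment containing the axioms, hence an upper bound for the smallest one.
  Stripping the quantifiers one at a time leads to the formulas with \<open>[k..<n]\<close>; for
  \<open>k = n\<close> this is the bare disjunction.\<close>

inductive_set closure_fms :: "('u, 'f, 'r) closure_fm set" where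
  atomic: "\<phi> \<in> atomic_fms voc_E \<Longrightarrow> \<phi> \<in> closure_fms"
| closure_all: "k \<le> n \<Longrightarrow> foldr All [k..<n] (disjunction n) \<in> closure_fms"
| closure_Q: "p \<in> pairs n \<Longrightarrow> Q_fm n p \<in> closure_fms"

lemma immediate_subfms_closure_fms:
  assumes "\<phi> \<in> closure_fms"
  shows "immediate_subfms \<phi> \<subseteq> closure_fms"
  using assms
proof cases
  case atomic
  then have "immediate_subfms \<phi> = {}" by (cases rule: atomic_fms.cases) auto
  then show ?thesis by simp
next
  case (closure_all k n)
  show ?thesis
  proof (cases "k = n")
    case True
    obtain F where F: "disjunction n = Disj F" "ran F = Q_fm n ` pairs n"
      using disjunction_family .
    have "immediate_subfms \<phi> = Q_fm n ` pairs n" by (simp add: closure_all(1) True F)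
    then show ?thesis using closure_Q by (simp add: image_subset_iff)
  next
    case False
    then have "immediate_subfms \<phi> = {foldr All [Suc k..<n] (disjunction n)}"
      using closure_all by (simp add: upt_conv_Cons)
    then show ?thesis using closure_fms.closure_all[of "Suc k" n] closure_all(2) False by simp
  qed
next
  case (closure_Q p n)
  have "immediate_subfms \<phi> = insert (E_fm n) (set (parameter_fms n))"
    by (simp add: closure_Q(1) Q_fm_def split: prod.split)
  also have "\<dots> \<subseteq> atomic_fms voc_E" using E_fm_atomic parameter_fms_atomic by simp
  also have "\<dots> \<subseteq> closure_fms" using closure_fms.atomic by (rule subsetI)
  finally show ?thesis .
qed

lemma closure_fms_in_struct_logic: "\<phi> \<in> closure_fms \<Longrightarrow> \<phi> \<in> struct_logic \<kappa> \<mu> voc_E"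
  by (induction rule: closure_fms.induct)
    (rule struct_logic.atomic foldr_All_in_struct_logic disjunction_in_struct_logic Q_fm_in_struct_logic;
      assumption?)+

lemma F_min_subset: "F_min \<subseteq> closure_fms"
proof -
  have "atomic_fms voc_E \<subseteq> closure_fms" using closure_fms.atomic by (rule subsetI)
  then have "fragment \<kappa> \<mu> voc_E closure_fms"
    using closure_fms_in_struct_logic immediate_subfms_closure_fms by (simp add: fragment_def subsetI)
  moreover have "range closure_axiom \<subseteq> closure_fms"
    using closure_all[of 0] by (auto simp: closure_axiom_def)
  ultimately show ?thesis unfolding smallest_fragment_def by (intro Inter_lower) simp
qed

text \<open>The starred relation constrains only the structural quantifiers in the fragment. These
  are reached from the axiom by descending through the universal quantifiers and the
  disjunction.\<close>

lemma Q_fm_in_F_min: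
  assumes "p \<in> pairs n"
  shows "Q_fm n p \<in> F_min"
  unfolding smallest_fragment_def
proof (rule InterI, clarify)
  fix F assume F: "fragment \<kappa> \<mu> voc_E F" "range closure_axiom \<subseteq> F"
  have sub: "immediate_subfms \<phi> \<subseteq> F" if "\<phi> \<in> F" for \<phi>
    using F(1) that by (auto simp: fragment_def)
  have "closure_axiom n \<in> F" using F(2) by blast
  then have "disjunction n \<in> F"
    unfolding closure_axiom_def using foldr_All_subfm[of F "[0..<n]" "disjunction n"] sub by blast
  moreover obtain G where "disjunction n = Disj G" "ran G = Q_fm n ` pairs n"
    using disjunction_family .
  ultimately have "Q_fm n ` pairs n \<subseteq> F" using sub[of "disjunction n"] by simp
  then show "Q_fm n p \<in> F" using assms by blast
qed

section \<open>Agreement of the two orderings\<close>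

lemma E_set_absolute:
  assumes "M \<in> expand ` K" "N \<in> expand ` K" "reduct \<tau> M \<preceq> reduct \<tau> N" "set a \<subseteq> univ M"
  shows "E_set M a = E_set N a"
proof -
  obtain P Q where P: "P \<in> K" "M = expand P" and Q: "Q \<in> K" "N = expand Q"
    using assms(1,2) by blast
  have le: "P \<preceq> Q" using assms(3) P Q by (simp add: reduct_expand)
  show ?thesis
    using hull_absolute[OF le, of "set a"] assms(4) P Q le_univ[OF le] by (simp add: E_set_expand)
qed

lemma elem_sub_starI:
  assumes MN: "M \<in> expand ` K" "N \<in> expand ` K" "reduct \<tau> M \<preceq> reduct \<tau> N"
  shows "elem_sub_star \<kappa> F_min M N"
proof -
  have sub: "substructure M N"
    using functorial_expansion_K_E MN by (auto simp: functorial_expansion_def K_E_def)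
  have voc: "voc M = voc_E" "voc N = voc_E" "univ M \<subseteq> univ N"
    using MN(1,2) sub by (auto simp: substructure_def)
  have E: "E_set M (map e [0..<n]) = E_set N (map e [0..<n])" if "e ` {..<n} \<subseteq> univ M" for e n
    using that by (intro E_set_absolute[OF MN]) auto
  \<comment> \<open>Both satisfaction clauses speak of the same \<open>E\<close>-set, and any
    substructure on it lies inside \<open>M\<close>.\<close>
  have Q: "sat M (Q_fm n p) e \<longleftrightarrow> sat N (Q_fm n p) e" if "p \<in> pairs n" and e: "e ` {..<n} \<subseteq> univ M" for n p e
  proof -
    obtain R A where p: "p = (R, A)" by fastforce
    have "subvocab (voc R) (voc M)" using pairs_wf(2) that(1) p voc(1) by simp
    then have "substructure N0 (reduct (voc R) M) \<longleftrightarrow> substructure N0 (reduct (voc R) N)"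
      if "univ N0 = E_set N (map e [0..<n])" for N0
      using substructure_reduct_absolute[OF sub, of "voc R" N0] that E[OF e] by (auto simp: E_set_def)
    moreover have "e ` {..<n} \<subseteq> univ N" using e voc(3) by blast
    ultimately show ?thesis unfolding p using e E[OF e] by (auto simp: sat_Q_fm)
  qed
  have "sat M \<phi> e \<longleftrightarrow> sat N \<phi> e" if \<phi>: "\<phi> \<in> F_min" and e: "e ` fv \<phi> \<subseteq> univ M" for \<phi> e
  proof -
    have "\<phi> \<in> closure_fms" using \<phi> F_min_subset by blast
    then show ?thesis
    proof cases
      case atomic
      then show ?thesis using sat_atomic_substructure[OF sub _ e] voc by simp
    next
      case (closure_all k n)
      \<comment> \<open>These formulas are preserved because they are true in both structures: the
        disjunction holds in every expanded member whenever its parameters lie in the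
        universe.\<close>
      have "sat N' \<phi> e" if "N' \<in> expand ` K" "univ M \<subseteq> univ N'" for N'
        unfolding closure_all(1)
      proof (rule sat_foldr_AllI[of "{..<k}"])
        have "{..<n} - set [k..<n] = {..<k}" using closure_all(2) by auto
        then show "e ` {..<k} \<subseteq> univ N'"
          using e that(2) by (simp add: closure_all(1) fv_foldr_All fv_disjunction del: set_upt)
        show "sat N' (disjunction n) e'" if "e' ` ({..<k} \<union> set [k..<n]) \<subseteq> univ N'" for e'
          using that closure_all(2) by (intro sat_disjunction_expand[OF \<open>N' \<in> expand ` K\<close>]) fastforce
      qed
      then show ?thesis using MN voc(3) by blast
    next
      case (closure_Q p n)
      then show ?thesis using Q e by (simp add: fv_Q_fm)
    qed
  qed
  then have elem: "elem_sub F_min M N" using sub by (simp add: elem_sub_def)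
  have eqs: "def_set M \<phi> x e = def_set N \<phi> x e \<and>
      (\<forall>i<length \<psi>s. def_set M (\<psi>s ! i) (ys ! i) e = def_set N (\<psi>s ! i) (ys ! i) e)"
    if q: "QStruct R A x \<phi> ys \<psi>s \<in> F_min" "e ` fv (QStruct R A x \<phi> ys \<psi>s) \<subseteq> univ M" for R A x \<phi> ys \<psi>s e
  proof -
    let ?q = "QStruct R A x \<phi> ys \<psi>s"
    have "?q \<in> closure_fms" using q(1) F_min_subset by blast
    \<comment> \<open>Atomic formulas and quantified disjunctions have other outermost constructors,
      so each structural quantifier in the fragment is some \<open>Q_fm n p\<close>.\<close>
    then obtain n p where p: "?q = Q_fm n p"
    proof cases
      case atomic
      then show ?thesis by (cases rule: atomic_fms.cases)
    next
      case (closure_all k n)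
      obtain F where "disjunction n = Disj F" using disjunction_family .
      then show ?thesis using closure_all(1) by (cases "[k..<n]") simp_all
    qed (use that in blast)
    then have e: "e ` {..<n} \<subseteq> univ M" "e ` {..<n} \<subseteq> univ N"
      using q(2) fv_Q_fm[of n p] voc(3) by auto
    have [simp]: "x = n" "\<phi> = E_fm n" "ys = replicate (Suc n) n" "\<psi>s = parameter_fms n"
      using p by (auto simp: Q_fm_def split: prod.splits)
    have "def_set M (parameter_fms n ! i) (replicate (Suc n) n ! i) e =
      def_set N (parameter_fms n ! i) (replicate (Suc n) n ! i) e" if "i < Suc n" for i
      using def_set_parameter_fms[OF e(1) that] def_set_parameter_fms[OF e(2) that] E[OF e(1)]
        nth_replicate[OF that, of n] by (simp del: replicate_Suc split: nat.split)
    then show ?thesis using E[OF e(1)] by (simp add: def_set_E_fm del: replicate_Suc)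
  qed
  show ?thesis
    unfolding elem_sub_star_def
    by (intro conjI[OF elem] allI impI, elim conjE) (rule eqs)
qed

text \<open>The closure of a finite tuple has fewer than \<kappa> elements, so the starred clause
  applies to it and makes the \<open>E\<close>-sets of both structures equal;
  \<open>reduct_leI\<close> does the rest.\<close>

lemma elem_sub_starD:
  assumes MN: "M \<in> expand ` K" "N \<in> expand ` K" and elem: "elem_sub_star \<kappa> F_min M N"
  shows "reduct \<tau> M \<preceq> reduct \<tau> N"
proof (rule reduct_leI[OF MN])
  show "substructure M N" using elem by (simp add: elem_sub_star_def elem_sub_def)
  fix a assume a: "set a \<subseteq> univ M"
  let ?n = "length a"
  let ?e = "\<lambda>i. if i < ?n then a ! i else undefined"
  have e: "?e ` {..<?n} \<subseteq> univ M" using a by auto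
  have map_e: "map ?e [0..<?n] = a" by (rule nth_equalityI) auto
  obtain P where P: "P \<in> K" "M = expand P" using MN(1) by blast
  have def_set_eq: "def_set M \<phi> x e = def_set N \<phi> x e"
    if "|def_set M \<phi> x e| <o \<kappa>" "QStruct R A x \<phi> ys \<psi>s \<in> F_min"
      "e ` fv (QStruct R A x \<phi> ys \<psi>s) \<subseteq> univ M" for R A x \<phi> ys \<psi>s e
    using elem[unfolded elem_sub_star_def, THEN conjunct2, THEN spec, THEN spec, THEN spec, THEN spec,
        THEN spec, THEN spec, THEN spec, THEN mp, OF conjI[OF that(2) conjI[OF that(3,1)]]]
    by (rule conjunct1)
  have "|def_set M (E_fm ?n) ?n ?e| <o \<kappa>"
    using hull_ordLess_\<kappa>[OF P(1), of "set a"] a P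
    by (simp add: def_set_E_fm map_e E_set_expand)
  \<comment> \<open>The dummy disjunct is in the fragment for every \<open>n\<close>. The starred
    clause concerns the sets defined by its formulas, which are the same for all pairs, and so it
    applies even though this disjunct is false.\<close>
  moreover have "Q_fm ?n (dummy_pair ?n) \<in> F_min" by (rule Q_fm_in_F_min) (simp add: pairs_def)
  moreover have "?e ` fv (Q_fm ?n (dummy_pair ?n)) \<subseteq> univ M" unfolding fv_Q_fm by (rule e)
  ultimately have "def_set M (E_fm ?n) ?n ?e = def_set N (E_fm ?n) ?n ?e"
    unfolding dummy_pair_def Q_fm_def prod.case by (intro def_set_eq)
  then show "E_set M a = E_set N a" by (simp add: def_set_E_fm map_e)
qed

lemma K_E_eq_Mod: "K_E = Mod \<kappa> voc_E F_min (range closure_axiom)"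
proof -
  have "reduct \<tau> M \<preceq> reduct \<tau> N \<longleftrightarrow> elem_sub_star \<kappa> F_min M N"
    if "M \<in> expand ` K" "N \<in> expand ` K" for M N
    by (rule iffI, erule elem_sub_starI[OF that], erule elem_sub_starD[OF that])
  then have "(M \<in> expand ` K \<and> N \<in> expand ` K \<and> reduct \<tau> M \<preceq> reduct \<tau> N) \<longleftrightarrow>
      (M \<in> expand ` K \<and> N \<in> expand ` K \<and> elem_sub_star \<kappa> F_min M N)" for M N
    by (intro conj_cong refl)
  then show ?thesis unfolding K_E_def Mod_def models_closure_axioms by (simp only:)
qed

end

theorem theorem3p9:
  fixes \<tau> :: "('f, 'r) vocab"
    and \<K> :: "('u, 'f, 'r) ordered_class"
    and E :: "nat \<Rightarrow> 'r"
  assumes "AEC \<tau> \<K>" and "has_intersections \<K>"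
    and "inj E" and "range E \<inter> dom (rels \<tau>) = {}"
  defines "\<kappa> \<equiv> cardSuc (LS \<tau> \<K>)"
    and "\<mu> \<equiv> cardSuc (LS \<tau> \<K> +c |D_set \<K>| )"
  shows "\<exists>\<tau>' \<K>' T.
    funs \<tau>' = funs \<tau> \<and> rels \<tau> \<subseteq>\<^sub>m rels \<tau>' \<and> dom (rels \<tau>') = dom (rels \<tau>) \<union> range E \<and>
    functorial_expansion \<tau> \<K> \<tau>' \<K>' \<and>
    T \<subseteq> struct_logic \<kappa> \<mu> \<tau>' \<and> (\<forall>\<chi> \<in> T. forall_Q_sentence \<chi>) \<and>
    \<K>' = Mod \<kappa> \<tau>' (smallest_fragment \<kappa> \<mu> \<tau>' T) T"
proof -
  interpret closure_expansion \<tau> \<K> E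
    using assms(1-4) by unfold_locales
  have "range closure_axiom \<subseteq> struct_logic \<kappa> \<mu> voc_E"
    unfolding \<kappa>_def \<mu>_def closure_axiom_def
    using foldr_All_in_struct_logic[OF disjunction_in_struct_logic] by (rule image_subsetI)
  moreover have "\<forall>\<chi>\<in>range closure_axiom. forall_Q_sentence \<chi>"
    using forall_Q_sentence_closure_axiom by simp
  moreover have "K_E = Mod \<kappa> voc_E (smallest_fragment \<kappa> \<mu> voc_E (range closure_axiom)) (range closure_axiom)"
    unfolding \<kappa>_def \<mu>_def by (rule K_E_eq_Mod)
  ultimately show ?thesis
    using rels_le_voc_E dom_rels_voc_E functorial_expansion_K_E
    by (intro exI[of _ voc_E] exI[of _ K_E] exI[of _ "range closure_axiom"] conjI funs_voc_E)
qed

end
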